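(* Let $d\ge 1$ be an integer. Every strongly chordal graph $G$ is $2,d$-perfect; that is, $\chi^2_d(H)=\omega^2_d(H)$ for all induced subgraphs $H$ of $G$. Hence, trees, block graphs and interval graphs are all $2,d$-perfect.
   Context: All graphs are simple and undirected with nonempty vertex set. A graph is chordal if every cycle of length at least $4$ has a chord. A graph is strongly chordal if it is chordal and every cycle of even length at least $6$ has an odd chord, i.e. a chord joining two vertices whose distance along the cycle is odd (and greater than $1$). A block graph is a graph in which every block (maximal $2$-connected subgraph, bridge, or isolated vertex) is a complete graph. An interval graph is the intersection graph of a family of intervals of the real line. A shortest path in a graph $G$ is a path between some vertices $u,v$ whose length (number of edges) equals the graph distance between $u$ and $v$. A set $S\subseteq V(G)$ is $2,d$-independent in $G$ if every shortest path in $G$ of length at most $d$ contains fewer than $2$ vertices of $S$. $\chi^2_d(G)$ is the least positive integer $c$ such that some coloring $V(G)\to\{1,\dots,c\}$ has all color classes $2,d$-independent. A set $S\subseteq V(G)$ is a $2,d$-clique in $G$ if every $2$-element subset of $S$ is contained in some shortest path of $G$ of length at most $d$; $\omega^2_d(G)$ is the supremum of the sizes of $2,d$-cliques in $G$. $G$ is $2,d$-perfect if $\chi^2_d(H)=\omega^2_d(H)$ for every induced subgraph $H$ of $G$ (shortest paths being computed in $H$). *)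

theory Defs
  imports
    "HOL-Analysis.Analysis"
    "HOL-Library.Extended_Nat"
    "Graph_Theory.Graph_Theory"
begin

text \<open>
  An undirected graph is a symmetric loopless digraph without parallel arcs, so the edge
  \<open>uv\<close> is the pair of arcs \<open>(u,v)\<close>, \<open>(v,u)\<close>. Graphs may be infinite.
\<close>

definition simple_graph :: "'a pair_pre_digraph \<Rightarrow> bool" where
  "simple_graph G \<longleftrightarrow> pair_bidirected_digraph G \<and> pverts G \<noteq> {}"

definition ecard :: "'a set \<Rightarrow> enat" where
  "ecard S = (if finite S then enat (card S) else \<infinity>)"


section \<open>Chordal and strongly chordal graphs\<close>

text \<open>
  A cycle is given by the list of its vertices, without repeating the first one at the end.
  The library's \<open>cycle\<close> and \<open>forest\<close> are not used: in a symmetric digraph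
  they count a single edge, traversed back and forth, as a cycle.
\<close>

definition is_cycle :: "'a pair_pre_digraph \<Rightarrow> 'a list \<Rightarrow> bool" where
  "is_cycle G c \<longleftrightarrow> 3 \<le> length c \<and> vpath c (with_proj G) \<and> (last c, hd c) \<in> parcs G"

text \<open>Distance along the cycle \<open>c\<close> between its positions \<open>i \<le> j\<close>.\<close>

definition cycle_dist :: "'a list \<Rightarrow> nat \<Rightarrow> nat \<Rightarrow> nat" where
  "cycle_dist c i j = min (j - i) (length c - (j - i))"

definition is_chord :: "'a pair_pre_digraph \<Rightarrow> 'a list \<Rightarrow> nat \<Rightarrow> nat \<Rightarrow> bool" where
  "is_chord G c i j \<longleftrightarrow>
     i < j \<and> j < length c \<and> (c ! i, c ! j) \<in> parcs G \<and> cycle_dist c i j > 1"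

definition chordal :: "'a pair_pre_digraph \<Rightarrow> bool" where
  "chordal G \<longleftrightarrow> (\<forall>c. is_cycle G c \<and> length c \<ge> 4 \<longrightarrow> (\<exists>i j. is_chord G c i j))"

definition strongly_chordal :: "'a pair_pre_digraph \<Rightarrow> bool" where
  "strongly_chordal G \<longleftrightarrow> chordal G \<and>
     (\<forall>c. is_cycle G c \<and> even (length c) \<and> length c \<ge> 6
        \<longrightarrow> (\<exists>i j. is_chord G c i j \<and> odd (cycle_dist c i j)))"


section \<open>Trees, block graphs and interval graphs\<close>

definition tree_graph :: "'a pair_pre_digraph \<Rightarrow> bool" where
  "tree_graph G \<longleftrightarrow> Digraph_Component.connected (with_proj G) \<and> (\<nexists>c. is_cycle G c)"

definition complete_graph :: "'a pair_pre_digraph \<Rightarrow> bool" where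
  "complete_graph G \<longleftrightarrow> (\<forall>u\<in>pverts G. \<forall>v\<in>pverts G. u \<noteq> v \<longrightarrow> (u, v) \<in> parcs G)"

text \<open>
  2-connected: more than two vertices, and no fewer than two vertices disconnect the graph.
\<close>

definition two_connected :: "'a pair_pre_digraph \<Rightarrow> bool" where
  "two_connected G \<longleftrightarrow> ecard (pverts G) > 2 \<and>
     (\<forall>X \<subseteq> pverts G. ecard X < 2 \<longrightarrow>
        Digraph_Component.connected (with_proj G \<restriction> (pverts G - X)))"

definition max_two_connected_subgraph ::
    "'a pair_pre_digraph \<Rightarrow> 'a pair_pre_digraph \<Rightarrow> bool" where
  "max_two_connected_subgraph G B \<longleftrightarrow>
     simple_graph B \<and> subgraph (with_proj B) (with_proj G) \<and> two_connected B \<and>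
     (\<forall>B'. simple_graph B' \<and> subgraph (with_proj B') (with_proj G) \<and> two_connected B' \<and>
           subgraph (with_proj B) (with_proj B') \<longrightarrow> B' = B)"

definition is_bridge :: "'a pair_pre_digraph \<Rightarrow> 'a \<Rightarrow> 'a \<Rightarrow> bool" where
  "is_bridge G u v \<longleftrightarrow> (u, v) \<in> parcs G \<and>
     \<not> u \<rightarrow>\<^sup>*\<^bsub>with_proj (G\<lparr>parcs := parcs G - {(u, v), (v, u)}\<rparr>)\<^esub> v"

definition is_isolated :: "'a pair_pre_digraph \<Rightarrow> 'a \<Rightarrow> bool" where
  "is_isolated G v \<longleftrightarrow> v \<in> pverts G \<and> (\<forall>u. (v, u) \<notin> parcs G)"

definition is_block :: "'a pair_pre_digraph \<Rightarrow> 'a pair_pre_digraph \<Rightarrow> bool" where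
  "is_block G B \<longleftrightarrow>
     max_two_connected_subgraph G B \<or>
     (\<exists>u v. is_bridge G u v \<and> B = \<lparr>pverts = {u, v}, parcs = {(u, v), (v, u)}\<rparr>) \<or>
     (\<exists>v. is_isolated G v \<and> B = \<lparr>pverts = {v}, parcs = {}\<rparr>)"

definition block_graph :: "'a pair_pre_digraph \<Rightarrow> bool" where
  "block_graph G \<longleftrightarrow> (\<forall>B. is_block G B \<longrightarrow> complete_graph B)"

text \<open>The intervals may be open, closed, half-open, unbounded, degenerate or empty (giving an isolated vertex).\<close>

definition interval_graph :: "'a pair_pre_digraph \<Rightarrow> bool" where
  "interval_graph G \<longleftrightarrow> (\<exists>I :: 'a \<Rightarrow> real set.
     (\<forall>v\<in>pverts G. is_interval (I v)) \<and>
     (\<forall>u\<in>pverts G. \<forall>v\<in>pverts G. u \<noteq> v \<longrightarrow> ((u, v) \<in> parcs G \<longleftrightarrow> I u \<inter> I v \<noteq> {})))"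


section \<open>Shortest paths and \<open>2,d\<close>-perfection\<close>

text \<open>The distance is \<open>\<infinity>\<close> if no walk joins the two vertices.\<close>

definition graph_dist :: "'a pair_pre_digraph \<Rightarrow> 'a \<Rightarrow> 'a \<Rightarrow> enat" where
  "graph_dist G u v =
     (INF p \<in> {p. vwalk p (with_proj G) \<and> hd p = u \<and> last p = v}. enat (vwalk_length p))"

definition shortest_path :: "'a pair_pre_digraph \<Rightarrow> 'a list \<Rightarrow> bool" where
  "shortest_path G p \<longleftrightarrow>
     vpath p (with_proj G) \<and> enat (vwalk_length p) = graph_dist G (hd p) (last p)"

definition independent_2 :: "nat \<Rightarrow> 'a pair_pre_digraph \<Rightarrow> 'a set \<Rightarrow> bool" where
  "independent_2 d G S \<longleftrightarrow> S \<subseteq> pverts G \<and>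
     (\<forall>p. shortest_path G p \<and> vwalk_length p \<le> d \<longrightarrow> card (set p \<inter> S) < 2)"

definition coloring_2 :: "nat \<Rightarrow> 'a pair_pre_digraph \<Rightarrow> nat \<Rightarrow> ('a \<Rightarrow> nat) \<Rightarrow> bool" where
  "coloring_2 d G c f \<longleftrightarrow> f \<in> pverts G \<rightarrow> {1..c} \<and>
     (\<forall>i\<in>{1..c}. independent_2 d G {v \<in> pverts G. f v = i})"

text \<open>The value is \<open>\<infinity>\<close> if no finite number of colors suffices.\<close>

definition chi_2 :: "nat \<Rightarrow> 'a pair_pre_digraph \<Rightarrow> enat" where
  "chi_2 d G = (INF c \<in> {c. c \<ge> 1 \<and> (\<exists>f. coloring_2 d G c f)}. enat c)"

definition clique_2 :: "nat \<Rightarrow> 'a pair_pre_digraph \<Rightarrow> 'a set \<Rightarrow> bool" where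
  "clique_2 d G S \<longleftrightarrow> S \<subseteq> pverts G \<and>
     (\<forall>T \<subseteq> S. card T = 2 \<longrightarrow>
        (\<exists>p. shortest_path G p \<and> vwalk_length p \<le> d \<and> T \<subseteq> set p))"

definition omega_2 :: "nat \<Rightarrow> 'a pair_pre_digraph \<Rightarrow> enat" where
  "omega_2 d G = (SUP S \<in> {S. clique_2 d G S}. ecard S)"

definition perfect_2 :: "nat \<Rightarrow> 'a pair_pre_digraph \<Rightarrow> bool" where
  "perfect_2 d G \<longleftrightarrow>
     (\<forall>H. induced_subgraph (with_proj H) (with_proj G) \<and> pverts H \<noteq> {}
        \<longrightarrow> chi_2 d H = omega_2 d H)"

end

theory Submission
  imports Defs
begin

text \<open>
  A colouring with \<open>2,d\<close>-independent classes is a proper colouring of the \<open>d\<close>-th power of the graph,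
  and a \<open>2,d\<close>-clique is a clique of that power. Greedy colouring along an elimination by simplicial
  vertices is optimal, and by compactness it is enough to eliminate finite vertex sets. A chordal graph
  has such eliminations by Dirac's argument; so has the square of a strongly chordal graph, because a
  hole in the square would yield an even cycle without odd chord. For the other powers we pass from the
  power \<open>k \<ge> 1\<close> to \<open>k + 2\<close>, as in Duchet's theorem. Reflexive adjacency relations are used throughout,
  so that distance at most \<open>d\<close> becomes membership in the \<open>d\<close>-th relational power.
\<close>

section \<open>Simplicial elimination\<close>

text \<open>Duchet's step raises a positive exponent by two, so odd exponents go back to 1 and even
  ones to 2. Exponent 1 is chordality itself; exponent 2 is the obstacle, because the square of a
  chordal graph may have a hole. In the 4-sun, a clique \<open>w 0, ..., w 3\<close> with further
  vertices \<open>p i\<close>, each attached to two cyclically consecutive \<open>w\<close>'s, the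
  four \<open>p i\<close> form a hole of the square, while the cycle alternating between the
  \<open>p\<close>'s and the \<open>w\<close>'s has no odd chord. The section on squares shows that
  every hole in the square of a hole-free graph leads to an alternating cycle of this kind, which is
  where odd chords are needed.\<close>

definition simplicial_in :: "'a rel \<Rightarrow> 'a set \<Rightarrow> 'a \<Rightarrow> bool" where
  "simplicial_in R U v \<longleftrightarrow> v \<in> U \<and> (\<forall>x\<in>U. \<forall>y\<in>U. (v, x) \<in> R \<longrightarrow> (v, y) \<in> R \<longrightarrow> (x, y) \<in> R)"

lemma simplicial_in_cong:
  assumes "\<And>x y. x \<in> U \<Longrightarrow> y \<in> U \<Longrightarrow> (x, y) \<in> R \<longleftrightarrow> (x, y) \<in> R'"
  shows "simplicial_in R U v \<longleftrightarrow> simplicial_in R' U v"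
  unfolding simplicial_in_def by (intro conj_cong ball_cong refl) (simp add: assms)

text \<open>For a finite reflexive symmetric relation this is chordality. Asking for a simplicial
  vertex in every finite subset makes the property hereditary and meaningful for infinite
  \<open>W\<close>.\<close>

definition eliminable :: "'a rel \<Rightarrow> 'a set \<Rightarrow> bool" where
  "eliminable R W \<longleftrightarrow> (\<forall>U\<subseteq>W. finite U \<longrightarrow> U \<noteq> {} \<longrightarrow> (\<exists>v. simplicial_in R U v))"

text \<open>Connectedness by cuts instead of walks: after a vertex has been deleted, only an edge
  leaving a given set has to be found again.\<close>

definition cut_connected :: "'a rel \<Rightarrow> 'a set \<Rightarrow> bool" where
  "cut_connected R S \<longleftrightarrow> (\<forall>A\<subseteq>S. A \<noteq> {} \<longrightarrow> A \<noteq> S \<longrightarrow> (\<exists>a\<in>A. \<exists>b\<in>S - A. (a, b) \<in> R))"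

text \<open>The analogue of the intersection graph of subtrees of a tree, with a chordal host graph
  and adjacency in place of intersection.\<close>

definition touching :: "'a rel \<Rightarrow> ('b \<Rightarrow> 'a set) \<Rightarrow> 'b rel" where
  "touching R S = {(x, y). \<exists>a\<in>S x. \<exists>b\<in>S y. (a, b) \<in> R}"

lemma cut_connected_star:
  assumes "sym R" "\<And>a. a \<in> S \<Longrightarrow> (c, a) \<in> R" "c \<in> S"
  shows "cut_connected R S"
  unfolding cut_connected_def
proof (intro allI impI)
  fix A assume A: "A \<subseteq> S" "A \<noteq> {}" "A \<noteq> S"
  show "\<exists>a\<in>A. \<exists>b\<in>S - A. (a, b) \<in> R"
  proof (cases "c \<in> A")
    case True
    then show ?thesis using A assms by blast
  next
    case False
    then show ?thesis using A assms by (metis Diff_iff ex_in_conv subsetD symD)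
  qed
qed

text \<open>A walk through a simplicial vertex can skip it, since its neighbours are adjacent. In
  terms of cuts: the edges leaving \<open>A\<close> and \<open>insert s A\<close> either contain one
  that avoids \<open>s\<close>, or they are \<open>a s\<close> and \<open>s b'\<close>, and then
  \<open>a\<close> and \<open>b'\<close> are adjacent.\<close>

lemma cut_connected_remove_simplicial:
  assumes S: "cut_connected R S" "S \<subseteq> W" and s: "simplicial_in R W s" and "sym R"
  shows "cut_connected R (S - {s})"
proof (cases "s \<in> S")
  case True
  show ?thesis
    unfolding cut_connected_def
  proof (intro allI impI)
    fix A assume A: "A \<subseteq> S - {s}" "A \<noteq> {}" "A \<noteq> S - {s}"
    then obtain a b where ab: "a \<in> A" "b \<in> S - A" "(a, b) \<in> R"
      using S(1) unfolding cut_connected_def by (metis Diff_subset subset_trans True insert_Diff insert_absorb subset_Diff_insert)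
    have "insert s A \<noteq> S" "insert s A \<subseteq> S"
      using A True by auto
    then obtain a' b' where ab': "a' \<in> insert s A" "b' \<in> S - insert s A" "(a', b') \<in> R"
      using S(1) unfolding cut_connected_def by (metis insert_not_empty)
    show "\<exists>a\<in>A. \<exists>b\<in>S - {s} - A. (a, b) \<in> R"
    proof (cases "b = s \<and> a' = s")
      case True
      then have "(s, a) \<in> R" "(s, b') \<in> R"
        using ab ab' \<open>sym R\<close> by (auto dest: symD)
      moreover have "a \<in> W" "b' \<in> W"
        using ab ab' A S(2) by auto
      ultimately have "(a, b') \<in> R"
        using s unfolding simplicial_in_def by blast
      then show ?thesis using ab ab' by blast
    next
      case False
      then show ?thesis using ab ab' by blast
    qed
  qed
next
  case False
  then show ?thesis using S(1) by simp
qed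

text \<open>Deleting a simplicial vertex from all the sets changes neither their connectedness nor
  which of them touch; a set consisting of that vertex alone touches only pairwise touching sets.\<close>

lemma ex_simplicial_touching:
  assumes "finite W" "eliminable R W" "sym R" "\<And>x. x \<in> W \<Longrightarrow> (x, x) \<in> R" "U \<noteq> {}"
    and "\<And>u. u \<in> U \<Longrightarrow> S u \<subseteq> W" "\<And>u. u \<in> U \<Longrightarrow> S u \<noteq> {}" "\<And>u. u \<in> U \<Longrightarrow> cut_connected R (S u)"
  shows "\<exists>v. simplicial_in (touching R S) U v"
  using assms
proof (induction W arbitrary: S rule: finite_psubset_induct)
  case (psubset W)
  have "W \<noteq> {}"
    using psubset.prems by fastforce
  then obtain s where s: "simplicial_in R W s"
    using psubset.prems(1) psubset.hyps unfolding eliminable_def by blast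
  have simp: "(x, y) \<in> R" if "x \<in> W" "y \<in> W" "(s, x) \<in> R" "(s, y) \<in> R" for x y
    using s that unfolding simplicial_in_def by blast
  show ?case
  proof (cases "\<exists>v\<in>U. S v = {s}")
    case True
    then obtain v where v: "v \<in> U" "S v = {s}" by blast
    have "(x, y) \<in> touching R S"
      if "x \<in> U" "y \<in> U" "(v, x) \<in> touching R S" "(v, y) \<in> touching R S" for x y
      using that v(2) simp psubset.prems(5) unfolding touching_def by simp blast
    then have "simplicial_in (touching R S) U v"
      unfolding simplicial_in_def using v(1) by blast
    then show ?thesis ..
  next
    case False
    \<comment> \<open>The cut \<open>{s}\<close> of a connected set other than \<open>{s}\<close>
      yields a neighbour of \<open>s\<close> in that set, which can replace \<open>s\<close> in
      every touching pair.\<close>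
    have nb: "\<exists>a'\<in>S u - {s}. (s, a') \<in> R" if "u \<in> U" "s \<in> S u" for u
      using psubset.prems(7)[OF that(1)] that False unfolding cut_connected_def
      by (metis empty_subsetI insert_not_empty insert_subset singletonD)
    have eq: "(x, y) \<in> touching R S \<longleftrightarrow> (x, y) \<in> touching R (\<lambda>u. S u - {s})"
      if xy: "x \<in> U" "y \<in> U" for x y
    proof
      assume "(x, y) \<in> touching R S"
      then obtain a b where ab: "a \<in> S x" "b \<in> S y" "(a, b) \<in> R"
        unfolding touching_def by blast
      have W: "S x \<subseteq> W" "S y \<subseteq> W"
        using psubset.prems(5) xy by auto
      have "\<exists>a'\<in>S x - {s}. (a', b) \<in> R"
      proof (cases "a = s")
        case True
        then obtain a' where "a' \<in> S x - {s}" "(s, a') \<in> R"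
          using nb xy ab by blast
        then show ?thesis
          using simp[of a' b] ab True W by blast
      qed (use ab in blast)
      then obtain a' where a': "a' \<in> S x - {s}" "(a', b) \<in> R" by blast
      have "\<exists>b'\<in>S y - {s}. (a', b') \<in> R"
      proof (cases "b = s")
        case True
        then obtain b' where "b' \<in> S y - {s}" "(s, b') \<in> R"
          using nb xy ab by blast
        moreover have "(s, a') \<in> R"
          using a' True psubset.prems(2) by (auto dest: symD)
        ultimately show ?thesis
          using simp[of a' b'] a' W by blast
      qed (use ab a' in blast)
      then show "(x, y) \<in> touching R (\<lambda>u. S u - {s})"
        using a'(1) unfolding touching_def by blast
    qed (auto simp: touching_def)
    have "\<exists>v. simplicial_in (touching R (\<lambda>u. S u - {s})) U v"
    proof (rule psubset.IH)
      show "W - {s} \<subset> W"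
        using s unfolding simplicial_in_def by auto
      show "eliminable R (W - {s})"
        using psubset.prems(1) unfolding eliminable_def by blast
      fix u assume u: "u \<in> U"
      show "S u - {s} \<subseteq> W - {s}" using psubset.prems(5)[OF u] by blast
      show "S u - {s} \<noteq> {}" using psubset.prems(6)[OF u] False u by blast
      show "cut_connected R (S u - {s})"
        using cut_connected_remove_simplicial[OF _ _ s] psubset.prems u by blast
    qed (use psubset.prems in auto)
    then show ?thesis
      using simplicial_in_cong[OF eq] by simp
  qed
qed

section \<open>Relational powers and the step from exponent \<open>k\<close> to
  \<open>k + 2\<close>\<close>

lemma sym_relpow:
  assumes "sym R"
  shows "sym (R ^^ n)"
proof (induction n)
  case (Suc n)
  then show ?case
    using assms by (metis relpow.simps(2) relpow_commute converse_relcomp sym_conv_converse_eq)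
qed (auto simp: sym_def)

text \<open>The zeroth power is the identity on the whole type and leaves
  \<open>V \<times> V\<close>, hence the bound on \<open>n\<close> here and in the results
  below.\<close>

lemma relpow_subset_Times:
  assumes "R \<subseteq> V \<times> V" "n \<ge> 1"
  shows "R ^^ n \<subseteq> V \<times> V"
  using assms(2)
proof (induction n rule: dec_induct)
  case (step n)
  then show ?case using assms(1) by auto
qed (use assms in auto)

lemma refl_on_relpow:
  assumes "refl_on V R"
  shows "refl_on V (R ^^ n)"
proof (induction n)
  case (Suc n)
  then show ?case using assms unfolding refl_on_def by auto
qed (auto simp: refl_on_def)

lemma relpow_mono_refl:
  assumes "R \<subseteq> V \<times> V" "refl_on V R" "m \<le> n" "m \<ge> 1"
  shows "R ^^ m \<subseteq> R ^^ n"
  using assms(3)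
proof (induction n rule: dec_induct)
  case (step n)
  have "R ^^ n \<subseteq> V \<times> V"
    using relpow_subset_Times[OF assms(1)] step assms(4) by simp
  then have "R ^^ n \<subseteq> R ^^ Suc n"
    using assms(2) unfolding refl_on_def by auto
  then show ?case using step by blast
qed auto

text \<open>Two vertices are at distance at most \<open>k + 2\<close> iff their closed neighbourhoods, which are
  connected, touch in the \<open>k\<close>-th power.\<close>

lemma eliminable_relpow_add_2:
  assumes R: "R \<subseteq> V \<times> V" "refl_on V R" "sym R" and k: "k \<ge> 1" and el: "eliminable (R ^^ k) V"
  shows "eliminable (R ^^ (k + 2)) V"
  unfolding eliminable_def
proof (intro allI impI)
  fix U assume U: "U \<subseteq> V" "finite U" "U \<noteq> {}"
  define Q where "Q = R ^^ k"
  have Q: "Q \<subseteq> V \<times> V" "refl_on V Q" "sym Q" "R \<subseteq> Q"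
    using relpow_subset_Times[OF R(1) k] refl_on_relpow[OF R(2)] sym_relpow[OF R(3)]
      relpow_mono_refl[OF R(1,2) k] by (auto simp: Q_def)
  have pow: "R ^^ (k + 2) = R O Q O R"
    unfolding Q_def by (metis O_assoc add_2_eq_Suc' relpow.simps(2) relpow_commute)
  have "\<forall>p\<in>U \<times> U \<inter> R ^^ (k + 2). \<exists>a b. (fst p, a) \<in> R \<and> (a, b) \<in> Q \<and> (b, snd p) \<in> R"
    unfolding pow by fastforce
  then obtain a b where ab: "\<And>u v. u \<in> U \<Longrightarrow> v \<in> U \<Longrightarrow> (u, v) \<in> R ^^ (k + 2) \<Longrightarrow>
     (u, a (u, v)) \<in> R \<and> (a (u, v), b (u, v)) \<in> Q \<and> (b (u, v), v) \<in> R"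
    by (metis (no_types, lifting) IntI SigmaI fst_conv snd_conv)
  \<comment> \<open>Full closed neighbourhoods may be infinite, but
    \<open>ex_simplicial_touching\<close> needs a finite ground set. It suffices to keep
    \<open>u\<close> itself and the ends of the middle pieces chosen for the finitely many pairs
    from \<open>U\<close>; what remains is still a star around \<open>u\<close>.\<close>
  define S where "S u = {u} \<union> (\<lambda>v. a (u, v)) ` {v \<in> U. (u, v) \<in> R ^^ (k + 2)}
    \<union> (\<lambda>v. b (v, u)) ` {v \<in> U. (v, u) \<in> R ^^ (k + 2)}" for u
  have SR: "(u, x) \<in> R" if u: "u \<in> U" and x: "x \<in> S u" for u x
  proof -
    consider "x = u" | v where "v \<in> U" "(u, v) \<in> R ^^ (k + 2)" "x = a (u, v)"
      | v where "v \<in> U" "(v, u) \<in> R ^^ (k + 2)" "x = b (v, u)"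
      using x unfolding S_def by blast
    then show ?thesis
    proof cases
      case 1
      then show ?thesis using u U(1) R(2) unfolding refl_on_def by blast
    next
      case 2
      then show ?thesis using ab[OF u] by blast
    next
      case 3
      then show ?thesis using ab[OF _ u] R(3) by (meson symD)
    qed
  qed
  have eq: "(u, v) \<in> touching Q S \<longleftrightarrow> (u, v) \<in> R ^^ (k + 2)" if "u \<in> U" "v \<in> U" for u v
  proof
    assume "(u, v) \<in> touching Q S"
    then show "(u, v) \<in> R ^^ (k + 2)"
      unfolding touching_def pow using SR that R(3) by simp (meson relcomp.relcompI symD)
  next
    assume uv: "(u, v) \<in> R ^^ (k + 2)"
    then have "a (u, v) \<in> S u" "b (u, v) \<in> S v"
      using that unfolding S_def by auto
    then show "(u, v) \<in> touching Q S"
      unfolding touching_def using ab[OF that uv] by blast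
  qed
  have SV: "S u \<subseteq> V" if "u \<in> U" for u
    using SR[OF that] R(1) by blast
  have "\<exists>v. simplicial_in (touching Q S) U v"
  proof (rule ex_simplicial_touching)
    show "finite (\<Union>u\<in>U. S u)"
      using U(2) by (auto simp: S_def)
    show "eliminable Q (\<Union>u\<in>U. S u)"
      using el SV unfolding Q_def eliminable_def by (meson UN_least subset_trans)
    fix u assume u: "u \<in> U"
    show "cut_connected Q (S u)"
    proof (rule cut_connected_star[of _ _ u])
      show "(u, x) \<in> Q" if "x \<in> S u" for x
        using SR[OF u that] Q by blast
    qed (use Q in \<open>auto simp: S_def\<close>)
    show "S u \<subseteq> (\<Union>u\<in>U. S u)"
      using u by blast
    show "S u \<noteq> {}"
      by (simp add: S_def)
  next
    show "(x, x) \<in> Q" if "x \<in> (\<Union>u\<in>U. S u)" for x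
      using that SV Q(2) unfolding refl_on_def by blast
  qed (use Q U in auto)
  then show "\<exists>v. simplicial_in (R ^^ (k + 2)) U v"
    by (simp only: simplicial_in_cong[OF eq])
qed

lemma eliminable_relpow:
  assumes R: "R \<subseteq> V \<times> V" "refl_on V R" "sym R"
    and "eliminable R V" "eliminable (R ^^ 2) V" and "d \<ge> 1"
  shows "eliminable (R ^^ d) V"
  using assms(6)
proof (induction d rule: less_induct)
  case (less d)
  consider "d = 1" | "d = 2" | "d - 2 \<ge> 1" "d - 2 < d" "d = (d - 2) + 2"
    using less.prems by linarith
  then show ?case
  proof cases
    case 3
    then show ?thesis
      using eliminable_relpow_add_2[OF R, of "d - 2"] less.IH by simp
  qed (use assms in auto)
qed

section \<open>Colouring\<close>

text \<open>A simplicial vertex \<open>v\<close> is coloured last. It forms a clique with its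
  neighbours, so these number at most \<open>k - 1\<close> and leave a colour free.\<close>

lemma greedy_coloring:
  assumes "finite U" "eliminable R U" "sym R" "refl_on U R"
    and "\<And>C. C \<subseteq> U \<Longrightarrow> C \<times> C \<subseteq> R \<Longrightarrow> card C \<le> k"
  shows "\<exists>f. f ` U \<subseteq> {1..k} \<and> (\<forall>x\<in>U. \<forall>y\<in>U. x \<noteq> y \<and> (x, y) \<in> R \<longrightarrow> f x \<noteq> f y)"
  using assms
proof (induction U rule: finite_psubset_induct)
  case (psubset U)
  show ?case
  proof (cases "U = {}")
    case False
    then obtain v where v: "simplicial_in R U v"
      using psubset.prems(1) psubset.hyps unfolding eliminable_def by blast
    then have vU: "v \<in> U" unfolding simplicial_in_def by blast
    have "\<exists>f. f ` (U - {v}) \<subseteq> {1..k} \<and>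
        (\<forall>x\<in>U - {v}. \<forall>y\<in>U - {v}. x \<noteq> y \<and> (x, y) \<in> R \<longrightarrow> f x \<noteq> f y)"
    proof (rule psubset.IH)
      show "eliminable R (U - {v})"
        using psubset.prems(1) unfolding eliminable_def by blast
      show "refl_on (U - {v}) R"
        using psubset.prems(3) unfolding refl_on_def by blast
      show "card C \<le> k" if "C \<subseteq> U - {v}" "C \<times> C \<subseteq> R" for C
        using psubset.prems(4) that by blast
    qed (use vU psubset.prems in auto)
    then obtain f where f: "f ` (U - {v}) \<subseteq> {1..k}"
        "\<forall>x\<in>U - {v}. \<forall>y\<in>U - {v}. x \<noteq> y \<and> (x, y) \<in> R \<longrightarrow> f x \<noteq> f y"
      by (elim exE conjE)
    define N where "N = {x \<in> U. (v, x) \<in> R}"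
    have "N \<times> N \<subseteq> R"
      using v unfolding N_def simplicial_in_def by blast
    then have "card N \<le> k"
      using psubset.prems(4) unfolding N_def by simp
    moreover have N: "v \<in> N" "finite N"
      using vU psubset.prems(3) psubset.hyps unfolding N_def refl_on_def by auto
    ultimately have "card (f ` (N - {v})) < card {1..k}"
      using card_image_le[of "N - {v}" f] card_Diff1_less[of N v] by simp
    then obtain c where c: "c \<in> {1..k}" "c \<notin> f ` (N - {v})"
      by (metis N(2) card_mono finite_Diff finite_imageI leD subsetI)
    have "(f(v := c)) ` U \<subseteq> {1..k}"
      using f(1) c(1) by auto
    moreover have "(f(v := c)) x \<noteq> (f(v := c)) y" if "x \<in> U" "y \<in> U" "x \<noteq> y" "(x, y) \<in> R" for x y
    proof -
      have "(y, x) \<in> R" using that psubset.prems(2) by (auto dest: symD)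
      have "f u \<noteq> c" if "u \<in> U" "u \<noteq> v" "(v, u) \<in> R" for u
        using that c(2) unfolding N_def by blast
      then show ?thesis
        using that \<open>(y, x) \<in> R\<close> f(2) by (cases "x = v"; cases "y = v") auto
    qed
    ultimately show ?thesis by blast
  qed auto
qed

text \<open>The theorem of de Bruijn and Erdos, by Tychonoff's theorem.\<close>

lemma coloring_compactness:
  fixes k :: nat
  assumes fin: "\<And>U. finite U \<Longrightarrow> U \<subseteq> V \<Longrightarrow>
      \<exists>f. f ` U \<subseteq> {1..k} \<and> (\<forall>x\<in>U. \<forall>y\<in>U. x \<noteq> y \<and> (x, y) \<in> R \<longrightarrow> f x \<noteq> f y)"
  shows "\<exists>f. f ` V \<subseteq> {1..k} \<and> (\<forall>x\<in>V. \<forall>y\<in>V. x \<noteq> y \<and> (x, y) \<in> R \<longrightarrow> f x \<noteq> f y)"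
proof (cases "V = {}")
  case False
  define X where "X = product_topology (\<lambda>_. discrete_topology {1..k}) V"
  define C where "C p = {f \<in> topspace X. f (fst p) \<noteq> f (snd p)}" for p :: "'a \<times> 'a"
  define E where "E = {(x, y). x \<in> V \<and> y \<in> V \<and> x \<noteq> y \<and> (x, y) \<in> R}"
  have top: "topspace X = (\<Pi>\<^sub>E x\<in>V. {1..k})"
    unfolding X_def by simp
  have "V \<noteq> {} \<Longrightarrow> k \<ge> 1"
    using fin[of "{SOME v. v \<in> V}"] by (auto simp: some_in_eq)
  then have k: "1 \<in> {1..k}" using False by simp
  have "compact_space X"
    unfolding X_def by (simp add: compact_space_product_topology compact_space_discrete_topology)
  have cl: "closedin X {f \<in> topspace X. f x \<in> D}" if "x \<in> V" "D \<subseteq> {1..k}" for x D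
    unfolding X_def
    by (rule closedin_continuous_map_preimage[OF continuous_map_product_projection[OF that(1)]])
      (use that in auto)
  have "closedin X (C p)" if "p \<in> E" for p
  proof -
    have "C p = (\<Union>i\<in>{1..k}. {f \<in> topspace X. f (fst p) \<in> {i}} \<inter> {f \<in> topspace X. f (snd p) \<in> {1..k} - {i}})"
      using that unfolding C_def E_def top by (fastforce simp: PiE_iff)
    also have "closedin X \<dots>"
    proof (intro closedin_Union finite_imageI ballI)
      fix S assume "S \<in> (\<lambda>i. {f \<in> topspace X. f (fst p) \<in> {i}} \<inter> {f \<in> topspace X. f (snd p) \<in> {1..k} - {i}}) ` {1..k}"
      then obtain i where i: "i \<in> {1..k}"
        "S = {f \<in> topspace X. f (fst p) \<in> {i}} \<inter> {f \<in> topspace X. f (snd p) \<in> {1..k} - {i}}"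
        by blast
      have "fst p \<in> V" "snd p \<in> V"
        using that by (auto simp: E_def)
      then show "closedin X S"
        unfolding i(2) using i(1) by (intro closedin_Int cl) auto
    qed simp
    finally show ?thesis .
  qed
  \<comment> \<open>Finitely many constraints \<open>C p\<close> concern only finitely many
    vertices. The whole space joins the family so that a point of the intersection is a colouring
    even if there are no constraints.\<close>
  moreover have "\<Inter> F \<noteq> {}" if F: "finite F" "F \<subseteq> insert (topspace X) (C ` E)" for F
  proof -
    have "finite (F - {topspace X})" "F - {topspace X} \<subseteq> C ` E"
      using F by auto
    then obtain E' where E': "E' \<subseteq> E" "finite E'" "F - {topspace X} = C ` E'"
      using finite_subset_image by metis
    define U where "U = fst ` E' \<union> snd ` E'"
    have "finite U" "U \<subseteq> V"
      using E' unfolding U_def E_def by auto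
    then obtain f where f: "f ` U \<subseteq> {1..k}" "\<forall>x\<in>U. \<forall>y\<in>U. x \<noteq> y \<and> (x, y) \<in> R \<longrightarrow> f x \<noteq> f y"
      using fin by meson
    \<comment> \<open>Vertices outside \<open>U\<close> are unconstrained and receive colour 1; the
      value \<open>undefined\<close> outside \<open>V\<close> is what membership in the extensional
      product demands.\<close>
    define g where "g x = (if x \<in> V then if x \<in> U then f x else 1 else undefined)" for x
    have gX: "g \<in> topspace X"
      unfolding top g_def using f(1) k by (auto simp: PiE_iff extensional_def)
    have gC: "g \<in> C p" if "p \<in> E'" for p
    proof -
      have "fst p \<in> U" "snd p \<in> U" "fst p \<noteq> snd p" "(fst p, snd p) \<in> R" "fst p \<in> V" "snd p \<in> V"
        using that E'(1) unfolding U_def E_def by auto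
      then show ?thesis
        using f(2) gX unfolding C_def g_def by simp
    qed
    have "g \<in> A" if "A \<in> F" for A
    proof (cases "A = topspace X")
      case False
      then have "A \<in> C ` E'" using that E'(3) by blast
      then show ?thesis using gC by blast
    qed (simp add: gX)
    then show ?thesis by (metis InterI empty_iff)
  qed
  ultimately have "\<Inter> (insert (topspace X) (C ` E)) \<noteq> {}"
    using \<open>compact_space X\<close>[unfolded compact_space_fip, rule_format, of "insert (topspace X) (C ` E)"]
    by (metis (no_types, lifting) closedin_topspace image_iff insert_iff)
  then obtain f where "f \<in> \<Inter> (insert (topspace X) (C ` E))"
    by (meson ex_in_conv)
  then have f: "f \<in> topspace X" "\<And>p. p \<in> E \<Longrightarrow> f \<in> C p"
    by simp_all
  have "f ` V \<subseteq> {1..k}"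
    using f(1) unfolding top by (auto simp: PiE_iff)
  moreover have "\<forall>x\<in>V. \<forall>y\<in>V. x \<noteq> y \<and> (x, y) \<in> R \<longrightarrow> f x \<noteq> f y"
  proof (intro ballI impI)
    fix x y assume "x \<in> V" "y \<in> V" "x \<noteq> y \<and> (x, y) \<in> R"
    then have "(x, y) \<in> E" by (simp add: E_def)
    from f(2)[OF this] show "f x \<noteq> f y" by (simp add: C_def)
  qed
  ultimately show ?thesis by (rule_tac x=f in exI) simp
qed auto

section \<open>Graphs without holes\<close>

definition hole :: "'a rel \<Rightarrow> 'a set \<Rightarrow> nat \<Rightarrow> (nat \<Rightarrow> 'a) \<Rightarrow> bool" where
  "hole R U n v \<longleftrightarrow> n \<ge> 4 \<and> inj_on v {..<n} \<and> v ` {..<n} \<subseteq> U \<and>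
     (\<forall>i<n. \<forall>j<n. (v i, v j) \<in> R \<longleftrightarrow> i = j \<or> j = Suc i mod n \<or> i = Suc j mod n)"

text \<open>A shortest path between \<open>s\<close> and \<open>t\<close> inside \<open>K\<close>, closed up by \<open>x\<close>, has no chords.\<close>

lemma adjacent_if_no_hole:
  assumes nh: "\<And>n v. \<not> hole R U n v" and sym: "sym R" and refl: "\<And>x. x \<in> U \<Longrightarrow> (x, x) \<in> R"
    and K: "K \<subseteq> U" "x \<in> U" "x \<notin> K" and path: "(s, t) \<in> (R \<inter> K \<times> K)\<^sup>*" "s \<noteq> t"
    and x: "(x, s) \<in> R" "(x, t) \<in> R" "\<And>k. k \<in> K \<Longrightarrow> (x, k) \<in> R \<Longrightarrow> k = s \<or> k = t"
  shows "(s, t) \<in> R"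
proof -
  define Q where "Q = R \<inter> K \<times> K"
  define n where "n = (LEAST n. (s, t) \<in> Q ^^ n)"
  have "(s, t) \<in> Q ^^ n"
    using path(1) unfolding n_def Q_def[symmetric] by (metis LeastI rtrancl_imp_relpow)
  have n_le: "n \<le> m" if "(s, t) \<in> Q ^^ m" for m
    using that unfolding n_def by (rule Least_le)
  obtain p where p: "p 0 = s" "p n = t" "\<And>i. i < n \<Longrightarrow> (p i, p (Suc i)) \<in> Q"
    using \<open>(s, t) \<in> Q ^^ n\<close> unfolding relpow_fun_conv by blast
  have sub: "(p i, p j) \<in> Q ^^ (j - i)" if "i \<le> j" "j \<le> n" for i j
    unfolding relpow_fun_conv using that p(3) by (intro exI[of _ "\<lambda>l. p (i + l)"]) auto
  have n0: "n \<noteq> 0"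
    using p(1,2) path(2) by metis
  have pK: "p i \<in> K" if "i \<le> n" for i
  proof (cases i)
    case 0
    then show ?thesis using p(3)[of 0] n0 unfolding Q_def by simp
  next
    case (Suc i')
    then show ?thesis using p(3)[of i'] that unfolding Q_def by simp
  qed
  \<comment> \<open>Skipping the part between two equal vertices would give a walk shorter than the
    least length \<open>n\<close>; the next fact uses a chord as the shortcut instead.\<close>
  have ne: "p i \<noteq> p j" if "i < j" "j \<le> n" for i j
  proof
    assume "p i = p j"
    then have "(s, t) \<in> Q ^^ (i + (n - j))"
      using sub[of 0 i] sub[of j n] p(1,2) that unfolding relpow_add by auto
    then show False using n_le that by fastforce
  qed
  have consec: "j = Suc i" if "i < j" "j \<le> n" "(p i, p j) \<in> R" for i j
  proof -
    have "(p i, p j) \<in> Q"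
      using that pK unfolding Q_def by simp
    then have "(p i, t) \<in> Q ^^ Suc (n - j)"
      using relpow_Suc_I2[of "p i" "p j"] sub[of j n] p(2) that by blast
    then have "(s, t) \<in> Q ^^ (i + Suc (n - j))"
      using sub[of 0 i] p(1) that unfolding relpow_add by auto
    then show ?thesis using n_le that by fastforce
  qed
  have R: "(a, b) \<in> R \<longleftrightarrow> (b, a) \<in> R" for a b
    using sym by (auto dest: symD)
  show ?thesis
  proof (cases "n = 1")
    case True
    then show ?thesis using p unfolding Q_def by force
  next
    case False
    \<comment> \<open>Position \<open>n + 1\<close> is taken by \<open>x\<close>. Here
      \<open>n \<ge> 2\<close>, so the closed cycle has length \<open>n + 2 \<ge> 4\<close>.\<close>
    define v where "v i = (if i \<le> n then p i else x)" for i
    have pp: "(p i, p j) \<in> R \<longleftrightarrow> i = j \<or> j = Suc i \<or> i = Suc j" if "i \<le> n" "j \<le> n" for i j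
      using consec[of i j] consec[of j i] p(3)[of i] p(3)[of j] that refl[of "p i"] pK[of i] K(1) R
      unfolding Q_def by (cases i j rule: linorder_cases) auto
    have xp: "(x, p i) \<in> R \<longleftrightarrow> i = 0 \<or> i = n" if "i \<le> n" for i
      using x(3)[OF pK[OF that]] ne[of 0 i] ne[of i n] that x(1,2) p(1,2) by (cases "i = 0"; cases "i = n") auto
    have "hole R U (n + 2) v"
      unfolding hole_def
    proof (intro conjI allI impI)
      show "inj_on v {..<n + 2}"
      proof (rule linorder_inj_onI)
        show "v i \<noteq> v j" if "i < j" "i \<in> {..<n + 2}" "j \<in> {..<n + 2}" for i j
          using that ne[of i j] pK[of i] K(3) unfolding v_def by auto
      qed auto
      show "v ` {..<n + 2} \<subseteq> U"
        using pK K unfolding v_def by auto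
      fix i j assume ij: "i < n + 2" "j < n + 2"
      have mod: "Suc i mod (n + 2) = (if i = n + 1 then 0 else Suc i)" if "i < n + 2" for i
        using that by (simp add: mod_Suc)
      show "(v i, v j) \<in> R \<longleftrightarrow> i = j \<or> j = Suc i mod (n + 2) \<or> i = Suc j mod (n + 2)"
        unfolding mod[OF ij(1)] mod[OF ij(2)]
        using ij pp[of i j] xp[of i] xp[of j] R[of "p i" x] refl[OF K(2)] unfolding v_def
        by (cases "i \<le> n"; cases "j \<le> n") auto
    qed (use n0 False in auto)
    then show ?thesis using nh by blast
  qed
qed

text \<open>Asking for a vertex not adjacent to \<open>x\<close> makes Dirac's induction work. Let
  \<open>C\<close> be the component of \<open>y\<close> among the non-neighbours of
  \<open>x\<close>, and \<open>B\<close> its boundary. Two vertices of \<open>B\<close> are joined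
  through \<open>C\<close>, and \<open>x\<close> closes this connection, so the absence of holes
  makes \<open>B\<close> a clique. The induction continues in \<open>C \<union> B\<close>, which
  misses \<open>x\<close>, and has to deliver a vertex of \<open>C\<close>.\<close>

lemma simplicial_away_from:
  assumes "finite U" "sym R" "\<And>x. x \<in> U \<Longrightarrow> (x, x) \<in> R" "\<And>n v. \<not> hole R U n v"
    and "x \<in> U" "y \<in> U" "(x, y) \<notin> R"
  shows "\<exists>v. simplicial_in R U v \<and> (x, v) \<notin> R"
  using assms
proof (induction U arbitrary: x y rule: finite_psubset_induct)
  case (psubset U)
  note sym = psubset.prems(1) and refl = psubset.prems(2) and nh = psubset.prems(3)
  note xy = psubset.prems(4-6)
  define D where "D = {u \<in> U. (x, u) \<notin> R}"
  define C where "C = {c. (y, c) \<in> (R \<inter> D \<times> D)\<^sup>*}"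
  define B where "B = {u \<in> U. (x, u) \<in> R \<and> (\<exists>c\<in>C. (c, u) \<in> R)}"
  have R: "(a, b) \<in> R \<longleftrightarrow> (b, a) \<in> R" for a b
    using sym by (auto dest: symD)
  have yD: "y \<in> D" using xy by (simp add: D_def)
  have yC: "y \<in> C" by (simp add: C_def)
  have CD: "C \<subseteq> D"
    unfolding C_def using yD by (auto elim: rtranclE)
  have C_step: "u \<in> C" if "c \<in> C" "u \<in> D" "(c, u) \<in> R" for c u
    using that CD unfolding C_def by (auto intro: rtrancl_into_rtrancl)
  have C_conn: "(y, c) \<in> (R \<inter> C \<times> C)\<^sup>*" if "c \<in> C" for c
  proof -
    have "(y, c) \<in> (R \<inter> D \<times> D)\<^sup>*" using that by (simp add: C_def)
    then show ?thesis
    proof (induction rule: rtrancl_induct)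
      case (step c c')
      then have "c \<in> C" "c' \<in> C" unfolding C_def by (auto intro: rtrancl_into_rtrancl)
      then show ?case using step by (auto intro: rtrancl_into_rtrancl)
    qed simp
  qed
  have C_conn2: "(c, c') \<in> (R \<inter> C \<times> C)\<^sup>*" if "c \<in> C" "c' \<in> C" for c c'
  proof -
    have "Relation.sym ((R \<inter> C \<times> C)\<^sup>*)"
      using sym by (intro sym_rtrancl) (auto simp: sym_def)
    then show ?thesis using C_conn[OF that(1)] C_conn[OF that(2)] by (meson rtrancl_trans symD)
  qed
  have B_clique: "(s, t) \<in> R" if "s \<in> B" "t \<in> B" for s t
  proof (cases "s = t")
    case True
    then show ?thesis using refl that unfolding B_def by blast
  next
    case False
    from that obtain c c' where c: "c \<in> C" "(c, s) \<in> R" "c' \<in> C" "(c', t) \<in> R"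
      unfolding B_def by blast
    let ?K = "insert s (insert t C)"
    have "(c, c') \<in> (R \<inter> ?K \<times> ?K)\<^sup>*"
      using C_conn2[OF c(1,3)] by (rule rtrancl_mono[THEN subsetD, rotated]) auto
    moreover have "(s, c) \<in> R \<inter> ?K \<times> ?K" "(c', t) \<in> R \<inter> ?K \<times> ?K"
      using c R by auto
    ultimately have path: "(s, t) \<in> (R \<inter> ?K \<times> ?K)\<^sup>*"
      by (meson converse_rtrancl_into_rtrancl rtrancl_into_rtrancl)
    have st: "s \<in> U" "t \<in> U" "(x, s) \<in> R" "(x, t) \<in> R"
      using that unfolding B_def by auto
    have CU: "C \<subseteq> U" "x \<notin> C" "\<And>c. c \<in> C \<Longrightarrow> (x, c) \<notin> R"
      using CD refl xy(1) unfolding D_def by auto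
    show ?thesis
    proof (rule adjacent_if_no_hole[OF nh sym refl _ _ _ path False])
      show "insert s (insert t C) \<subseteq> U" using st CU by blast
      show "x \<notin> insert s (insert t C)" using c CU R by blast
      show "k = s \<or> k = t" if "k \<in> insert s (insert t C)" "(x, k) \<in> R" for k
        using that CU(3) by blast
    qed (use st xy in auto)
  qed
  define H where "H = C \<union> B"
  have HU: "H \<subset> U"
  proof -
    have "x \<notin> C" using CD refl xy(1) unfolding D_def by auto
    moreover have "x \<notin> B"
      using CD R unfolding B_def D_def by auto
    ultimately show ?thesis using xy(1) CD unfolding H_def D_def B_def by auto
  qed
  have nhH: "\<not> hole R H n v" for n v
    using nh[of n v] HU unfolding hole_def by blast
  \<comment> \<open>A neighbour of \<open>v\<close> in \<open>U\<close> is either a non-neighbour of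
    \<open>x\<close>, hence in \<open>C\<close>, or a neighbour of \<open>x\<close>, hence in
    \<open>B\<close>; so \<open>H\<close> contains the whole neighbourhood of
    \<open>v\<close>.\<close>
  have lift: "simplicial_in R U v \<and> (x, v) \<notin> R" if v: "simplicial_in R H v" "v \<in> C" for v
  proof -
    have "u \<in> H" if "u \<in> U" "(v, u) \<in> R" for u
      using that v(2) C_step[of v u] unfolding H_def B_def D_def by blast
    then show ?thesis
      using v HU CD unfolding simplicial_in_def D_def by blast
  qed
  show ?case
  proof (cases "\<exists>a\<in>H. \<exists>b\<in>H. (a, b) \<notin> R")
    case False
    then have "simplicial_in R H y"
      using yC unfolding simplicial_in_def H_def by blast
    then show ?thesis using lift yC by blast
  next
    case True
    have IH: "\<exists>v. simplicial_in R H v \<and> (a, v) \<notin> R" if "a \<in> H" "b \<in> H" "(a, b) \<notin> R" for a b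
      using psubset.IH[OF HU sym _ nhH that] refl HU by blast
    \<comment> \<open>The simplicial vertex must avoid \<open>B\<close>. If some \<open>a\<close> in
      \<open>B\<close> has a non-neighbour, a vertex not adjacent to \<open>a\<close> is outside the
      clique \<open>B\<close>; otherwise the vertices of \<open>B\<close> are adjacent to all of
      \<open>H\<close>, and any vertex with a non-neighbour is in \<open>C\<close>.\<close>
    show ?thesis
    proof (cases "\<exists>a\<in>B. \<exists>b\<in>H. (a, b) \<notin> R")
      case True
      then obtain a v where "a \<in> B" "simplicial_in R H v" "(a, v) \<notin> R"
        using IH unfolding H_def by blast
      moreover from this have "v \<in> C"
        using B_clique unfolding simplicial_in_def H_def by blast
      ultimately show ?thesis using lift by blast
    next
      case False
      then obtain a v where "a \<in> H" "simplicial_in R H v" "(a, v) \<notin> R"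
        using IH \<open>\<exists>a\<in>H. \<exists>b\<in>H. (a, b) \<notin> R\<close> by blast
      moreover from this have "v \<in> C"
        using False R unfolding simplicial_in_def H_def by blast
      ultimately show ?thesis using lift by blast
    qed
  qed
qed

lemma eliminable_if_no_hole:
  assumes "sym R" "refl_on V R" "\<And>n v. \<not> hole R V n v"
  shows "eliminable R V"
  unfolding eliminable_def
proof (intro allI impI)
  fix U assume U: "U \<subseteq> V" "finite U" "U \<noteq> {}"
  have nh: "\<not> hole R U n v" for n v
    using assms(3)[of n v] U(1) unfolding hole_def by blast
  have refl: "(x, x) \<in> R" if "x \<in> U" for x
    using assms(2) U(1) that unfolding refl_on_def by blast
  show "\<exists>v. simplicial_in R U v"
  proof (cases "\<exists>x\<in>U. \<exists>y\<in>U. (x, y) \<notin> R")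
    case True
    then show ?thesis using simplicial_away_from[OF U(2) assms(1) refl nh] by blast
  next
    case False
    then show ?thesis using U(3) unfolding simplicial_in_def by blast
  qed
qed

section \<open>The square of a strongly chordal graph\<close>

text \<open>Indices run through all naturals and count modulo \<open>m\<close>, so that rotations of
  a cycle become translations; equality is included to match reflexive relations.\<close>

definition cyc_adj :: "nat \<Rightarrow> nat \<Rightarrow> nat \<Rightarrow> bool" where
  "cyc_adj m i j \<longleftrightarrow> i mod m = j mod m \<or> Suc i mod m = j mod m \<or> Suc j mod m = i mod m"

lemma add_mod_cancel: "(r + i) mod m = (r + j) mod m \<longleftrightarrow> i mod m = (j mod m :: nat)"
proof (induction r)
  case (Suc r)
  have "Suc a mod m = Suc b mod m \<longleftrightarrow> a mod m = b mod m" for a b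
    by (cases "m = 0") (auto simp: mod_Suc split: if_splits)
  then show ?case using Suc by simp
qed simp

lemma cyc_adj_shift: "cyc_adj m (r + i) (r + j) \<longleftrightarrow> cyc_adj m i j"
  unfolding cyc_adj_def using add_mod_cancel[of r] by (metis add_Suc_right)

text \<open>A cycle of length at least 4 contains no triangle.\<close>

lemma cyc_adj_both:
  assumes "m \<ge> 4" "cyc_adj m i j" "cyc_adj m i (Suc j)"
  shows "i mod m = j mod m \<or> i mod m = Suc j mod m"
  using assms mod_less_divisor[of m i] mod_less_divisor[of m j]
  unfolding cyc_adj_def mod_Suc by (auto split: if_splits)

text \<open>A hole of the square of a hole-free relation, extended periodically. Translating
  \<open>p\<close> gives another instance, so facts proved at the indices 0 and 1 hold
  everywhere.\<close>

locale square_hole =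
  fixes R :: "'a rel" and V :: "'a set" and m :: nat and p :: "nat \<Rightarrow> 'a"
  assumes RV: "R \<subseteq> V \<times> V" and refl: "refl_on V R" and sym: "sym R"
    and nh: "\<And>n v. \<not> hole R V n v"
    and m: "m \<ge> 4" and pV: "p i \<in> V" and p_eq: "p i = p j \<longleftrightarrow> i mod m = j mod m"
    and pp: "(p i, p j) \<in> R ^^ 2 \<longleftrightarrow> cyc_adj m i j"
begin

text \<open>A middle vertex between consecutive \<open>p\<close>'s. Preferring
  \<open>p (Suc i)\<close> when it is adjacent to \<open>p i\<close> excludes
  \<open>w i = p i\<close>, and it identifies \<open>w 1\<close> with \<open>p 2\<close> whenever
  \<open>p 2\<close> is a neighbour of \<open>p 1\<close>.\<close>

definition w :: "nat \<Rightarrow> 'a" where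
  "w i = (if (p i, p (Suc i)) \<in> R then p (Suc i) else (SOME a. (p i, a) \<in> R \<and> (a, p (Suc i)) \<in> R))"

lemma R_sym: "(a, b) \<in> R \<longleftrightarrow> (b, a) \<in> R"
  using sym by (auto dest: symD)

lemma R_square: "(a, b) \<in> R \<Longrightarrow> (b, c) \<in> R \<Longrightarrow> (a, c) \<in> R ^^ 2"
  by (auto simp: numeral_2_eq_2)

lemma w: "(p i, w i) \<in> R" "(w i, p (Suc i)) \<in> R" "w i \<noteq> p i"
proof -
  have "(p i, p (Suc i)) \<in> R ^^ 2"
    unfolding pp cyc_adj_def by simp
  then have ex: "\<exists>a. (p i, a) \<in> R \<and> (a, p (Suc i)) \<in> R"
    by (auto simp: numeral_2_eq_2)
  have r: "(p (Suc i), p (Suc i)) \<in> R"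
    using refl pV unfolding refl_on_def by blast
  show w12: "(p i, w i) \<in> R" "(w i, p (Suc i)) \<in> R"
    using someI_ex[OF ex] r unfolding w_def by auto
  show "w i \<noteq> p i"
  proof
    assume eq: "w i = p i"
    then have "(p i, p (Suc i)) \<in> R" using w12 by simp
    then have "p i = p (Suc i)" using eq unfolding w_def by simp
    then show False
      using m unfolding p_eq by (simp add: mod_Suc split: if_splits)
  qed
qed

text \<open>Through \<open>w j\<close> the vertex \<open>p i\<close> is within two steps of both
  \<open>p j\<close> and \<open>p (Suc j)\<close>, and the hole has no triangle.\<close>

lemma w_adj:
  assumes "(w j, p i) \<in> R"
  shows "i mod m = j mod m \<or> i mod m = Suc j mod m"
proof (rule cyc_adj_both[OF m])
  show "cyc_adj m i j" "cyc_adj m i (Suc j)"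
    using R_square w[of j] assms R_sym pp by blast+
qed

text \<open>Otherwise the cycle through the \<open>p j\<close> and the \<open>w j\<close> has no chord at \<open>p 1\<close>, so that the
  neighbours \<open>p 0\<close> and \<open>w 1\<close> of \<open>p 1\<close> are adjacent.\<close>

lemma not_adjacent_0_1: "(p 0, p 1) \<notin> R"
proof
  assume 01: "(p 0, p 1) \<in> R"
  \<comment> \<open>The vertices of the walk \<open>w 1\<close>, \<open>p 2\<close>,
    \<open>w 2\<close>, ..., \<open>w (m - 1)\<close>, \<open>p m = p 0\<close>. Since
    \<open>p 0\<close> and \<open>p 1\<close> are adjacent, \<open>w 0\<close> is \<open>p 1\<close>
    and stays outside.\<close>
  define K where "K = p ` {2..m} \<union> w ` {1..<m}"
  have path: "(w 1, p j) \<in> (R \<inter> K \<times> K)\<^sup>*" if "2 \<le> j" "j \<le> m" for j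
    using that
  proof (induction j rule: dec_induct)
    case base
    have "(w 1, p 2) \<in> R \<inter> K \<times> K"
      using w(2)[of 1] m unfolding K_def by (auto simp: numeral_2_eq_2)
    then show ?case by blast
  next
    case (step j)
    have "(p j, w j) \<in> R \<inter> K \<times> K" "(w j, p (Suc j)) \<in> R \<inter> K \<times> K"
      using step w[of j] unfolding K_def by auto
    then show ?case using step by (meson Suc_leD rtrancl_into_rtrancl)
  qed
  have pm: "p m = p 0" using p_eq by simp
  have adj: "(p 0, w 1) \<notin> R"
    using w_adj[of 1 0] R_sym m by auto
  have "(w 1, p 0) \<in> R"
  proof (rule adjacent_if_no_hole[OF nh sym])
    show "(x, x) \<in> R" if "x \<in> V" for x
      using that refl unfolding refl_on_def by blast
    show "K \<subseteq> V"
      using pV w RV unfolding K_def by blast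
    show "p 1 \<in> V" by (rule pV)
    show "p 1 \<notin> K"
    proof
      assume "p 1 \<in> K"
      then consider j where "2 \<le> j" "j \<le> m" "p 1 = p j" | j where "1 \<le> j" "j < m" "p 1 = w j"
        unfolding K_def by auto
      then show False
      proof cases
        case 1
        then show False using m unfolding p_eq by (cases "j = m") auto
      next
        case 2
        then have "(w j, p 1) \<in> R"
          using refl pV[of 1] unfolding refl_on_def by metis
        then have "j = 1"
          using w_adj[of j 1] 2 m by (auto simp: mod_Suc split: if_splits)
        then show False using 2 w(3)[of 1] by simp
      qed
    qed
    show "(w 1, p 0) \<in> (R \<inter> K \<times> K)\<^sup>*"
      using path[of m] m pm by simp
    show "w 1 \<noteq> p 0"
      using adj refl pV[of 0] unfolding refl_on_def by metis
    show "(p 1, w 1) \<in> R" "(p 1, p 0) \<in> R"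
      using w(1) 01 R_sym by auto
    fix k assume "k \<in> K" and k: "(p 1, k) \<in> R"
    then consider j where "2 \<le> j" "j \<le> m" "k = p j" | j where "1 \<le> j" "j < m" "k = w j"
      unfolding K_def by auto
    then show "k = w 1 \<or> k = p 0"
    proof cases
      case 1
      have "(p 1, p j) \<in> R ^^ 2"
        using k 1 R_square refl pV unfolding refl_on_def by blast
      then have "j = 2 \<or> j = m"
        using 1 m unfolding pp cyc_adj_def by (cases "j = m") (auto simp: mod_Suc split: if_splits)
      moreover have "w 1 = p 2" if "j = 2"
        using k 1 that unfolding w_def by (simp add: numeral_2_eq_2)
      ultimately show ?thesis using 1 pm by auto
    next
      case 2
      then have "j = 1"
        using w_adj[of j 1] k R_sym m by (auto simp: mod_Suc split: if_splits)
      then show ?thesis using 2 by simp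
    qed
  qed
  then show False using adj R_sym by blast
qed

end

lemma square_hole_shift:
  assumes "square_hole R V m p"
  shows "square_hole R V m (\<lambda>i. p (r + i))"
  using assms unfolding square_hole_def by (simp add: cyc_adj_shift add_mod_cancel)

context square_hole
begin

lemma not_adjacent: "(p i, p (Suc i)) \<notin> R"
  using square_hole.not_adjacent_0_1[OF square_hole_shift[OF square_hole_axioms, of i]] by simp

text \<open>Otherwise \<open>w j\<close> would be \<open>p j\<close> or \<open>p (Suc j)\<close>,
  making these two adjacent.\<close>

lemma p_neq_w: "p i \<noteq> w j"
proof
  assume eq: "p i = w j"
  then have "(w j, p i) \<in> R"
    using refl pV[of i] unfolding refl_on_def by metis
  then have "p i = p j \<or> p i = p (Suc j)"
    using w_adj p_eq by blast
  then show False
    using eq w[of j] not_adjacent[of j] by metis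
qed

text \<open>A shared middle vertex would be adjacent to at least three of the \<open>p\<close>'s,
  while \<open>w_adj\<close> allows two.\<close>

lemma w_inj:
  assumes "w i = w j" "i < m" "j < m"
  shows "i = j"
proof -
  have "i mod m = j mod m \<or> i mod m = Suc j mod m" "Suc i mod m = j mod m \<or> Suc i mod m = Suc j mod m"
    using w_adj[of j] w[of i] assms(1) R_sym by metis+
  then show ?thesis
    using assms m by (auto simp: mod_Suc split: if_splits)
qed

definition u :: "nat \<Rightarrow> 'a" where
  "u i = (if even i then p (i div 2) else w (i div 2))"

lemma u_inj: "inj_on u {..<2 * m}"
proof (rule inj_onI)
  fix i j assume ij: "i \<in> {..<2 * m}" "j \<in> {..<2 * m}" "u i = u j"
  then have "i div 2 < m" "j div 2 < m" by auto
  moreover have "even i \<longleftrightarrow> even j"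
    using ij(3) p_neq_w unfolding u_def by (metis (full_types))
  moreover from this have "p (i div 2) = p (j div 2) \<or> w (i div 2) = w (j div 2)"
    using ij(3) unfolding u_def by (auto split: if_splits)
  ultimately have "i div 2 = j div 2"
    using w_inj p_eq by auto
  then show "i = j"
    using \<open>even i \<longleftrightarrow> even j\<close> by (metis bit_eq_rec)
qed

lemma u_edge:
  assumes "i < 2 * m"
  shows "(u i, u (Suc i mod (2 * m))) \<in> R"
proof (cases "even i")
  case True
  then obtain a where a: "i = 2 * a" by blast
  then have "Suc i mod (2 * m) = Suc (2 * a)" using assms by (auto simp: mod_Suc)
  then show ?thesis using w(1)[of a] by (simp add: u_def a)
next
  case False
  then obtain a where a: "i = 2 * a + 1" using oddE by blast
  have "u (Suc i mod (2 * m)) = p (Suc a)"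
  proof (cases "Suc a = m")
    case True
    then have "Suc i = 2 * m" using a by simp
    then show ?thesis using True p_eq[of 0 m] by (simp add: u_def)
  next
    case False
    then have "Suc i mod (2 * m) = 2 * Suc a" using a assms by (auto simp: mod_Suc)
    then show ?thesis by (simp add: u_def)
  qed
  then show ?thesis using w(2)[of a] by (simp add: u_def a)
qed

text \<open>By parity an odd chord joins a \<open>p\<close> to a \<open>w\<close>, and by
  \<open>w_adj\<close> such a pair is adjacent only if it is consecutive on the cycle.\<close>

lemma u_no_odd_chord:
  assumes "i < j" "j < 2 * m" "(u i, u j) \<in> R" "odd (j - i)" "j - i > 1" "2 * m - (j - i) > 1"
  shows False
proof (cases "even i")
  case True
  then have "odd j" using assms by auto
  then obtain a b where ab: "i = 2 * a" "j = 2 * b + 1"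
    using True by (metis evenE oddE)
  then have "(w b, p a) \<in> R" using assms(3) R_sym by (auto simp: u_def)
  then show False
    using w_adj[of b a] ab assms by (auto simp: mod_Suc split: if_splits)
next
  case False
  then have "even j" using assms by auto
  then obtain a b where ab: "j = 2 * a" "i = 2 * b + 1"
    using False by (metis evenE oddE)
  then have "(w b, p a) \<in> R" using assms(3) by (auto simp: u_def)
  then show False
    using w_adj[of b a] ab assms by (auto simp: mod_Suc split: if_splits)
qed

end

lemma square_no_hole:
  assumes R: "R \<subseteq> V \<times> V" "refl_on V R" "sym R" "\<And>n v. \<not> hole R V n v"
    and odd: "\<And>n u. even n \<Longrightarrow> n \<ge> 6 \<Longrightarrow> inj_on u {..<n} \<Longrightarrow> (\<And>i. i < n \<Longrightarrow> (u i, u (Suc i mod n)) \<in> R) \<Longrightarrow>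
      \<exists>i j. i < j \<and> j < n \<and> (u i, u j) \<in> R \<and> odd (j - i) \<and> j - i > 1 \<and> n - (j - i) > 1"
  shows "\<not> hole (R ^^ 2) V m v"
proof
  assume h: "hole (R ^^ 2) V m v"
  then have m: "m \<ge> 4" unfolding hole_def by simp
  then have less: "i mod m < m" for i by simp
  interpret square_hole R V m "\<lambda>i. v (i mod m)"
  proof
    show "v (i mod m) \<in> V" for i
      using h less unfolding hole_def by blast
    show "v (i mod m) = v (j mod m) \<longleftrightarrow> i mod m = j mod m" for i j
      using h less unfolding hole_def inj_on_def by (metis lessThan_iff)
    show "(v (i mod m), v (j mod m)) \<in> R ^^ 2 \<longleftrightarrow> cyc_adj m i j" for i j
      using h less[of i] less[of j] unfolding hole_def cyc_adj_def by (auto simp: mod_Suc_eq)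
  qed (use R m in auto)
  have "\<exists>i j. i < j \<and> j < 2 * m \<and> (u i, u j) \<in> R \<and> odd (j - i) \<and> j - i > 1 \<and> 2 * m - (j - i) > 1"
    by (rule odd) (use u_inj u_edge m in auto)
  then show False
    using u_no_odd_chord by blast
qed

section \<open>Walks, cycles and powers of the adjacency relation\<close>

definition radj :: "'a pair_pre_digraph \<Rightarrow> 'a rel" where
  "radj G = {(u, v). u \<in> pverts G \<and> v \<in> pverts G \<and> (u = v \<or> (u, v) \<in> parcs G)}"

lemma simple_graphD:
  assumes "simple_graph G"
  shows "(u, v) \<in> parcs G \<Longrightarrow> u \<in> pverts G" "(u, v) \<in> parcs G \<Longrightarrow> v \<in> pverts G"
    "(u, v) \<in> parcs G \<Longrightarrow> (v, u) \<in> parcs G" "(u, u) \<notin> parcs G"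
proof -
  interpret pair_bidirected_digraph G using assms unfolding simple_graph_def by blast
  show "(u, v) \<in> parcs G \<Longrightarrow> u \<in> pverts G" "(u, v) \<in> parcs G \<Longrightarrow> v \<in> pverts G"
    by (auto dest: wellformed')
  show "(u, v) \<in> parcs G \<Longrightarrow> (v, u) \<in> parcs G"
    using pair_sym_arcs unfolding symmetric_def by (auto dest: symD)
  show "(u, u) \<notin> parcs G"
    using pair_no_loops by fastforce
qed

lemma simple_graphI:
  assumes "\<And>u v. (u, v) \<in> parcs G \<Longrightarrow> u \<in> pverts G \<and> v \<in> pverts G \<and> (v, u) \<in> parcs G \<and> u \<noteq> v"
    and "pverts G \<noteq> {}"
  shows "simple_graph G"
  unfolding simple_graph_def
proof
  show "pair_bidirected_digraph G"
  proof
    show "symmetric (with_proj G)"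
      using assms(1) by (auto simp: symmetric_def intro!: symI)
  qed (use assms(1) in \<open>metis prod.collapse\<close>)+
qed (rule assms(2))

lemma radj:
  assumes "simple_graph G"
  shows "radj G \<subseteq> pverts G \<times> pverts G" "refl_on (pverts G) (radj G)" "sym (radj G)"
  using simple_graphD[OF assms] by (auto simp: radj_def refl_on_def sym_def)

lemma set_vwalk_arcs: "set (vwalk_arcs p) = {(p ! i, p ! Suc i) |i. Suc i < length p}"
proof (induction p rule: vwalk_arcs.induct)
  case (3 x y xs)
  have "{i. Suc i < length (x # y # xs)} = insert 0 (Suc ` {i. Suc i < length (y # xs)})"
    by (auto simp: less_Suc_eq_0_disj image_iff)
  then show ?case using 3 by (simp add: setcompr_eq_image image_image)
qed auto

lemma vwalk_with_proj_iff:
  "vwalk p (with_proj G) \<longleftrightarrow>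
     p \<noteq> [] \<and> set p \<subseteq> pverts G \<and> (\<forall>i. Suc i < length p \<longrightarrow> (p ! i, p ! Suc i) \<in> parcs G)"
  unfolding vwalk_def set_vwalk_arcs by auto

lemma is_cycle_iff:
  "is_cycle G c \<longleftrightarrow> 3 \<le> length c \<and> distinct c \<and> set c \<subseteq> pverts G \<and>
     (\<forall>i<length c. (c ! i, c ! (Suc i mod length c)) \<in> parcs G)"
proof (cases "3 \<le> length c")
  case True
  define n where "n = length c"
  have n: "3 \<le> n" using True by (simp add: n_def)
  have "(last c, hd c) = (c ! (n - 1), c ! (Suc (n - 1) mod n))"
    using n last_conv_nth[of c] hd_conv_nth[of c] by (cases "c = []") (auto simp: n_def)
  moreover have "(\<forall>i<n. (c ! i, c ! (Suc i mod n)) \<in> parcs G) \<longleftrightarrow>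
      (\<forall>i. Suc i < n \<longrightarrow> (c ! i, c ! Suc i) \<in> parcs G) \<and> (c ! (n - 1), c ! (Suc (n - 1) mod n)) \<in> parcs G"
    (is "?l \<longleftrightarrow> ?r")
  proof
    assume l: ?l
    show ?r
    proof (intro conjI allI impI)
      fix i assume "Suc i < n"
      then show "(c ! i, c ! Suc i) \<in> parcs G" using l[rule_format, of i] by simp
    qed (use l[rule_format, of "n - 1"] n in simp)
  next
    assume r: ?r
    show ?l
    proof (intro allI impI)
      fix i assume i: "i < n"
      show "(c ! i, c ! (Suc i mod n)) \<in> parcs G"
        using r i by (cases "Suc i = n") auto
    qed
  qed
  ultimately show ?thesis
    using n unfolding is_cycle_def vpath_def vwalk_with_proj_iff n_def by auto
qed (simp add: is_cycle_def)

lemma vwalk_relpow: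
  assumes "vwalk p (with_proj G)" "i \<le> j" "j < length p"
  shows "(p ! i, p ! j) \<in> radj G ^^ (j - i)"
  unfolding relpow_fun_conv
proof (intro exI[of _ "\<lambda>l. p ! (i + l)"] conjI allI impI)
  fix l assume "l < j - i"
  then have "i + l \<in> {..<length p}" "Suc (i + l) \<in> {..<length p}"
    using assms by auto
  then show "(p ! (i + l), p ! (i + Suc l)) \<in> radj G"
    using assms(1) unfolding vwalk_with_proj_iff radj_def by (auto simp: subset_iff)
qed (use assms in auto)

text \<open>Loop steps of the reflexive relation are dropped, so the walk may be shorter than the
  exponent.\<close>

lemma relpow_vwalk:
  assumes "(u, v) \<in> radj G ^^ n" "v \<in> pverts G"
  shows "\<exists>p. vwalk p (with_proj G) \<and> hd p = u \<and> last p = v \<and> vwalk_length p \<le> n"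
  using assms(1)
proof (induction n arbitrary: u)
  case 0
  then show ?case using assms(2) by (intro exI[of _ "[v]"]) auto
next
  case (Suc n)
  then obtain x where x: "(u, x) \<in> radj G" "(x, v) \<in> radj G ^^ n"
    by (meson relpow_Suc_D2)
  then obtain p where p: "vwalk p (with_proj G)" "hd p = x" "last p = v" "vwalk_length p \<le> n"
    using Suc.IH by blast
  then have ne: "p \<noteq> []" by auto
  show ?case
  proof (cases "u = x")
    case True
    then show ?thesis using p by (intro exI[of _ p]) auto
  next
    case False
    then have "vwalk (u # p) (with_proj G)"
      using x p by (intro vwalk_consI) (auto simp: radj_def)
    then show ?thesis using p ne by (intro exI[of _ "u # p"]) auto
  qed
qed

section \<open>Shortest paths, cliques and colourings in terms of powers\<close>

lemma length_vwalk_to_vpath: "length (vwalk_to_vpath p) \<le> length p"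
proof (induction p rule: vwalk_to_vpath.induct)
  case (2 x xs)
  then show ?case
    using length_dropWhile_le[of "\<lambda>y. y \<noteq> x" xs] by auto
qed simp

text \<open>A walk of least length exists, and pruning its repetitions does not lengthen it; the
  resulting path attains the infimum over walks.\<close>

lemma ex_shortest_path:
  assumes "vwalk q (with_proj G)" "hd q = u" "last q = v"
  shows "\<exists>p. shortest_path G p \<and> hd p = u \<and> last p = v \<and> vwalk_length p \<le> vwalk_length q"
proof -
  let ?W = "\<lambda>p. vwalk p (with_proj G) \<and> hd p = u \<and> last p = v"
  obtain p where p: "?W p" and min: "\<And>p'. ?W p' \<Longrightarrow> vwalk_length p \<le> vwalk_length p'"
    using ex_has_least_nat[of ?W q vwalk_length] assms by blast
  define r where "r = vwalk_to_vpath p"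
  have r: "vpath r (with_proj G)" "hd r = u" "last r = v"
    using p vwalk_to_vpath_vpath[of p] vwalk_to_vpath_hd[of p] vwalk_to_vpath_last[of p]
    unfolding r_def by auto
  have "vwalk_length r \<le> vwalk_length p"
    using length_vwalk_to_vpath[of p] unfolding r_def by simp
  then have min': "vwalk_length r \<le> vwalk_length p'" if "?W p'" for p'
    using min[OF that] by simp
  have "enat (vwalk_length r) = graph_dist G u v"
    unfolding graph_dist_def
  proof (rule antisym)
    show "enat (vwalk_length r) \<le> (INF p\<in>{p. ?W p}. enat (vwalk_length p))"
      using min' by (intro INF_greatest) auto
    show "(INF p\<in>{p. ?W p}. enat (vwalk_length p)) \<le> enat (vwalk_length r)"
      using r by (intro INF_lower) auto
  qed
  then show ?thesis
    using r min'[of q] assms unfolding shortest_path_def by auto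
qed

text \<open>Two vertices on a path are no further apart than its length; conversely, a shortest path
  between them serves. This reduces both 2,d-notions to adjacency in the power.\<close>

lemma shortest_path_through_iff:
  assumes "simple_graph G" "d \<ge> 1" "u \<noteq> v" "u \<in> pverts G" "v \<in> pverts G"
  shows "(\<exists>p. shortest_path G p \<and> vwalk_length p \<le> d \<and> {u, v} \<subseteq> set p) \<longleftrightarrow> (u, v) \<in> radj G ^^ d"
proof
  assume "\<exists>p. shortest_path G p \<and> vwalk_length p \<le> d \<and> {u, v} \<subseteq> set p"
  then obtain p where p: "vwalk p (with_proj G)" "vwalk_length p \<le> d" "u \<in> set p" "v \<in> set p"
    unfolding shortest_path_def by auto
  obtain i j where ij: "i < length p" "j < length p" "u = p ! i" "v = p ! j"
    using p(3,4) by (metis in_set_conv_nth)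
  have key: "(p ! i, p ! j) \<in> radj G ^^ d" if "i < j" "j < length p" for i j
  proof -
    have "j - i \<le> d" "j - i \<ge> 1" using that p(2) by auto
    then have "radj G ^^ (j - i) \<subseteq> radj G ^^ d"
      by (rule relpow_mono_refl[OF radj(1,2)[OF assms(1)]])
    then show ?thesis using vwalk_relpow[OF p(1), of i j] that by auto
  qed
  have "i \<noteq> j" using ij assms(3) by auto
  then show "(u, v) \<in> radj G ^^ d"
    using key[of i j] key[of j i] ij sym_relpow[OF radj(3)[OF assms(1)], of d]
    by (meson linorder_neqE_nat symD)
next
  assume "(u, v) \<in> radj G ^^ d"
  then obtain q where q: "vwalk q (with_proj G)" "hd q = u" "last q = v" "vwalk_length q \<le> d"
    using relpow_vwalk assms(5) by metis
  then obtain p where p: "shortest_path G p" "hd p = u" "last p = v" "vwalk_length p \<le> d"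
    using ex_shortest_path by (metis le_trans)
  then have "p \<noteq> []"
    unfolding shortest_path_def by auto
  then show "\<exists>p. shortest_path G p \<and> vwalk_length p \<le> d \<and> {u, v} \<subseteq> set p"
    using p hd_in_set last_in_set by (intro exI[of _ p]) fastforce
qed

lemma clique_2_iff:
  assumes "simple_graph G" "d \<ge> 1"
  shows "clique_2 d G S \<longleftrightarrow> S \<subseteq> pverts G \<and> S \<times> S \<subseteq> radj G ^^ d"
proof (cases "S \<subseteq> pverts G")
  case True
  have refl: "(u, u) \<in> radj G ^^ d" if "u \<in> S" for u
    using refl_on_relpow[OF radj(2)[OF assms(1)]] that True unfolding refl_on_def by blast
  have "clique_2 d G S \<longleftrightarrow> (\<forall>u\<in>S. \<forall>v\<in>S. u \<noteq> v \<longrightarrow>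
      (\<exists>p. shortest_path G p \<and> vwalk_length p \<le> d \<and> {u, v} \<subseteq> set p))" (is "_ \<longleftrightarrow> ?r")
  proof
    assume l: "clique_2 d G S"
    show ?r
    proof (intro ballI impI)
      fix u v assume "u \<in> S" "v \<in> S" "u \<noteq> v"
      then have "{u, v} \<subseteq> S" "card {u, v} = 2" by auto
      then show "\<exists>p. shortest_path G p \<and> vwalk_length p \<le> d \<and> {u, v} \<subseteq> set p"
        using l unfolding clique_2_def by blast
    qed
  next
    assume r: ?r
    show "clique_2 d G S"
      unfolding clique_2_def
    proof (intro conjI allI impI)
      fix T assume "T \<subseteq> S" "card T = 2"
      then obtain u v where "T = {u, v}" "u \<noteq> v" "u \<in> S" "v \<in> S"
        unfolding card_2_iff by auto
      then show "\<exists>p. shortest_path G p \<and> vwalk_length p \<le> d \<and> T \<subseteq> set p"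
        using r by blast
    qed (rule True)
  qed
  also have "\<dots> \<longleftrightarrow> (\<forall>u\<in>S. \<forall>v\<in>S. u \<noteq> v \<longrightarrow> (u, v) \<in> radj G ^^ d)"
  proof (intro ball_cong refl imp_cong)
    fix u v assume "u \<in> S" "v \<in> S" "u \<noteq> v"
    then show "(\<exists>p. shortest_path G p \<and> vwalk_length p \<le> d \<and> {u, v} \<subseteq> set p) \<longleftrightarrow> (u, v) \<in> radj G ^^ d"
      using shortest_path_through_iff[OF assms] True by blast
  qed auto
  also have "\<dots> \<longleftrightarrow> S \<times> S \<subseteq> radj G ^^ d"
    using refl by (auto, metis)
  finally show ?thesis using True by simp
qed (simp add: clique_2_def)

lemma independent_2_iff:
  assumes "simple_graph G" "d \<ge> 1"
  shows "independent_2 d G S \<longleftrightarrow>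
    S \<subseteq> pverts G \<and> (\<forall>u\<in>S. \<forall>v\<in>S. u \<noteq> v \<longrightarrow> (u, v) \<notin> radj G ^^ d)"
proof (cases "S \<subseteq> pverts G")
  case True
  have card: "card (set p \<inter> S) < 2 \<longleftrightarrow> (\<forall>u\<in>S. \<forall>v\<in>S. u \<noteq> v \<longrightarrow> \<not> {u, v} \<subseteq> set p)" for p
  proof -
    have "card (set p \<inter> S) < 2 \<longleftrightarrow> (\<forall>u\<in>set p \<inter> S. \<forall>v\<in>set p \<inter> S. u = v)"
      using card_le_Suc0_iff_eq[of "set p \<inter> S"] by auto
    then show ?thesis by blast
  qed
  have "independent_2 d G S \<longleftrightarrow> (\<forall>u\<in>S. \<forall>v\<in>S. u \<noteq> v \<longrightarrow>
      \<not> (\<exists>p. shortest_path G p \<and> vwalk_length p \<le> d \<and> {u, v} \<subseteq> set p))"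
    unfolding independent_2_def card using True by metis
  also have "\<dots> \<longleftrightarrow> (\<forall>u\<in>S. \<forall>v\<in>S. u \<noteq> v \<longrightarrow> (u, v) \<notin> radj G ^^ d)"
  proof (intro ball_cong refl imp_cong arg_cong[of _ _ Not])
    fix u v assume "u \<in> S" "v \<in> S" "u \<noteq> v"
    then show "(\<exists>p. shortest_path G p \<and> vwalk_length p \<le> d \<and> {u, v} \<subseteq> set p) \<longleftrightarrow> (u, v) \<in> radj G ^^ d"
      using shortest_path_through_iff[OF assms] True by blast
  qed
  finally show ?thesis using True by simp
qed (simp add: independent_2_def)

lemma coloring_2_iff:
  assumes "simple_graph G" "d \<ge> 1"
  shows "coloring_2 d G c f \<longleftrightarrow> f ` pverts G \<subseteq> {1..c} \<and>
    (\<forall>u\<in>pverts G. \<forall>v\<in>pverts G. u \<noteq> v \<and> (u, v) \<in> radj G ^^ d \<longrightarrow> f u \<noteq> f v)"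
proof -
  have "coloring_2 d G c f \<longleftrightarrow> f ` pverts G \<subseteq> {1..c} \<and> (\<forall>i\<in>{1..c}. \<forall>u\<in>pverts G. \<forall>v\<in>pverts G.
      f u = i \<longrightarrow> f v = i \<longrightarrow> u \<noteq> v \<longrightarrow> (u, v) \<notin> radj G ^^ d)"
    unfolding coloring_2_def independent_2_iff[OF assms] by auto
  also have "\<dots> \<longleftrightarrow> f ` pverts G \<subseteq> {1..c} \<and>
      (\<forall>u\<in>pverts G. \<forall>v\<in>pverts G. u \<noteq> v \<and> (u, v) \<in> radj G ^^ d \<longrightarrow> f u \<noteq> f v)"
    by (intro conj_cong refl) (metis image_subset_iff)
  finally show ?thesis .
qed

section \<open>Strongly chordal graphs\<close>

lemma eliminable_strongly_chordal:
  assumes G: "simple_graph G" and sc: "strongly_chordal G" and d: "d \<ge> 1"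
  shows "eliminable (radj G ^^ d) (pverts G)"
proof -
  note R = radj[OF G]
  have cyc: "is_cycle G (map v [0..<n])"
    if n: "n \<ge> 4" "inj_on v {..<n}" and e: "\<And>i. i < n \<Longrightarrow> (v i, v (Suc i mod n)) \<in> radj G"
    for n and v :: "nat \<Rightarrow> 'a"
    unfolding is_cycle_iff
  proof (intro conjI allI impI)
    show "distinct (map v [0..<n])"
      using n(2) by (simp add: distinct_map atLeast0LessThan)
    show "set (map v [0..<n]) \<subseteq> pverts G"
      using e R(1) by fastforce
    fix i assume "i < length (map v [0..<n])"
    then have i: "i < n" by simp
    have "Suc i mod n \<noteq> i" "Suc i mod n < n"
      using i n(1) by (auto simp: mod_Suc)
    then have "v i \<noteq> v (Suc i mod n)"
      using n(2) i unfolding inj_on_def by (metis lessThan_iff)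
    then show "(map v [0..<n] ! i, map v [0..<n] ! (Suc i mod length (map v [0..<n]))) \<in> parcs G"
      using e[OF i] i \<open>Suc i mod n < n\<close> unfolding radj_def by simp
  qed (use n in simp)
  have no_hole: "\<not> hole (radj G) (pverts G) n v" for n v
  proof
    assume h: "hole (radj G) (pverts G) n v"
    then have n: "n \<ge> 4" "inj_on v {..<n}"
      and e: "\<And>i j. i < n \<Longrightarrow> j < n \<Longrightarrow> (v i, v j) \<in> radj G \<longleftrightarrow> i = j \<or> j = Suc i mod n \<or> i = Suc j mod n"
      unfolding hole_def by blast+
    have "is_cycle G (map v [0..<n])"
      using e n(1) by (intro cyc[OF n]) auto
    then obtain i j where "is_chord G (map v [0..<n]) i j"
      using sc n(1) unfolding strongly_chordal_def chordal_def by fastforce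
    then have ij: "i < j" "j < n" "(v i, v j) \<in> parcs G" "min (j - i) (n - (j - i)) > 1"
      unfolding is_chord_def cycle_dist_def by auto
    then have "(v i, v j) \<in> radj G"
      using simple_graphD[OF G] unfolding radj_def by blast
    then have "j = Suc i mod n \<or> i = Suc j mod n"
      using e ij by auto
    then show False
      using ij by (auto simp: mod_Suc split: if_splits)
  qed
  have no_hole2: "\<not> hole (radj G ^^ 2) (pverts G) n v" for n v
  proof (rule square_no_hole[OF R no_hole])
    fix n and u :: "nat \<Rightarrow> 'a"
    assume n: "even n" "6 \<le> n" "inj_on u {..<n}" and e: "\<And>i. i < n \<Longrightarrow> (u i, u (Suc i mod n)) \<in> radj G"
    have "is_cycle G (map u [0..<n])"
      using cyc[OF _ n(3) e] n(2) by simp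
    then obtain i j where ij: "is_chord G (map u [0..<n]) i j" "odd (cycle_dist (map u [0..<n]) i j)"
      using sc n unfolding strongly_chordal_def by fastforce
    then have *: "i < j" "j < n" "(u i, u j) \<in> parcs G" "min (j - i) (n - (j - i)) > 1"
      "odd (min (j - i) (n - (j - i)))"
      unfolding is_chord_def cycle_dist_def by auto
    \<comment> \<open>As \<open>n\<close> is even, the two arcs between the positions have the same
      parity, so it does not matter which one is the shorter.\<close>
    then have "odd (j - i)"
      using n(1) by (auto simp: min_def split: if_splits)
    moreover have "(u i, u j) \<in> radj G"
      using * simple_graphD[OF G] unfolding radj_def by blast
    ultimately show "\<exists>i j. i < j \<and> j < n \<and> (u i, u j) \<in> radj G \<and> odd (j - i) \<and> j - i > 1 \<and> n - (j - i) > 1"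
      using * by (intro exI[of _ i] exI[of _ j]) simp
  qed
  show ?thesis
    using eliminable_if_no_hole[OF R(3,2) no_hole]
      eliminable_if_no_hole[OF sym_relpow[OF R(3)] refl_on_relpow[OF R(2)] no_hole2]
    by (intro eliminable_relpow[OF R _ _ d]) auto
qed

text \<open>A colouring is injective on every clique; with finitely many colours this also forces
  cliques to be finite.\<close>

lemma omega_2_le_chi_2:
  assumes "simple_graph G" "d \<ge> 1"
  shows "omega_2 d G \<le> chi_2 d G"
  unfolding omega_2_def chi_2_def
proof (intro SUP_least INF_greatest)
  fix S c assume "S \<in> {S. clique_2 d G S}" "c \<in> {c. 1 \<le> c \<and> (\<exists>f. coloring_2 d G c f)}"
  then obtain f where f: "f ` pverts G \<subseteq> {1..c}"
      "\<forall>u\<in>pverts G. \<forall>v\<in>pverts G. u \<noteq> v \<and> (u, v) \<in> radj G ^^ d \<longrightarrow> f u \<noteq> f v"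
    and S: "S \<subseteq> pverts G" "S \<times> S \<subseteq> radj G ^^ d"
    unfolding clique_2_iff[OF assms] coloring_2_iff[OF assms] by auto
  have "inj_on f S"
    unfolding inj_on_def
  proof (intro ballI impI)
    fix u v assume uv: "u \<in> S" "v \<in> S" "f u = f v"
    then have "u \<in> pverts G" "v \<in> pverts G" "(u, v) \<in> radj G ^^ d"
      using S by auto
    then show "u = v" using f(2) uv(3) by metis
  qed
  moreover have "f ` S \<subseteq> {1..c}" using f(1) S(1) by auto
  ultimately have "finite S" "card S \<le> c"
    using inj_on_finite[of f S "{1..c}"] card_inj_on_le[of f S "{1..c}"] by auto
  then show "ecard S \<le> enat c"
    by (simp add: ecard_def)
qed

lemma chi_2_eq_omega_2:
  assumes G: "simple_graph G" and sc: "strongly_chordal G" and d: "d \<ge> 1"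
  shows "chi_2 d G = omega_2 d G"
proof (rule antisym[OF _ omega_2_le_chi_2[OF G d]])
  show "chi_2 d G \<le> omega_2 d G"
  proof (cases "omega_2 d G")
    \<comment> \<open>An infinite supremum makes the inequality trivial. A finite one bounds the
      cliques in all finite vertex sets, which are then coloured greedily with \<open>k\<close>
      colours.\<close>
    case (enat k)
    note R = radj[OF G]
    have clique: "ecard S \<le> enat k" if "S \<subseteq> pverts G" "S \<times> S \<subseteq> radj G ^^ d" for S
      unfolding enat[symmetric] omega_2_def using that clique_2_iff[OF G d]
      by (intro SUP_upper) simp
    obtain x where x: "x \<in> pverts G" using G unfolding simple_graph_def by blast
    have "(x, x) \<in> radj G ^^ d"
      using refl_on_relpow[OF R(2)] x unfolding refl_on_def by blast
    \<comment> \<open>\<open>chi_2\<close> ranges over positive numbers of colours only; a single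
      vertex is a clique.\<close>
    then have k: "k \<ge> 1"
      using clique[of "{x}"] x by (simp add: ecard_def one_enat_def)
    have "\<exists>f. f ` pverts G \<subseteq> {1..k} \<and>
      (\<forall>u\<in>pverts G. \<forall>v\<in>pverts G. u \<noteq> v \<and> (u, v) \<in> radj G ^^ d \<longrightarrow> f u \<noteq> f v)"
    proof (rule coloring_compactness)
      fix U assume U: "finite U" "U \<subseteq> pverts G"
      show "\<exists>f. f ` U \<subseteq> {1..k} \<and> (\<forall>u\<in>U. \<forall>v\<in>U. u \<noteq> v \<and> (u, v) \<in> radj G ^^ d \<longrightarrow> f u \<noteq> f v)"
      proof (rule greedy_coloring[OF U(1)])
        show "eliminable (radj G ^^ d) U"
          using eliminable_strongly_chordal[OF G sc d] U(2) unfolding eliminable_def by blast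
        show "refl_on U (radj G ^^ d)"
          using refl_on_relpow[OF R(2), of d] U(2) unfolding refl_on_def by blast
        show "card C \<le> k" if "C \<subseteq> U" "C \<times> C \<subseteq> radj G ^^ d" for C
          using clique[of C] that U finite_subset[of C U] by (simp add: ecard_def)
      qed (rule sym_relpow[OF R(3)])
    qed
    then have "\<exists>f. coloring_2 d G k f"
      unfolding coloring_2_iff[OF G d] .
    then have "chi_2 d G \<le> enat k"
      unfolding chi_2_def using k by (intro INF_lower) simp
    then show ?thesis using enat by simp
  qed simp
qed

section \<open>Passing to induced subgraphs\<close>

lemma induced_subgraphD:
  assumes "induced_subgraph (with_proj H) (with_proj G)"
  shows "pverts H \<subseteq> pverts G"
    "(u, v) \<in> parcs H \<longleftrightarrow> (u, v) \<in> parcs G \<and> u \<in> pverts H \<and> v \<in> pverts H"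
proof -
  show "pverts H \<subseteq> pverts G"
    using assms by (simp add: induced_subgraph_def subgraph_def)
  have "parcs H = {e \<in> parcs G. fst e \<in> pverts H \<and> snd e \<in> pverts H}"
    using assms by (simp add: induced_subgraph_def)
  then show "(u, v) \<in> parcs H \<longleftrightarrow> (u, v) \<in> parcs G \<and> u \<in> pverts H \<and> v \<in> pverts H"
    by (metis (no_types, lifting) fst_conv mem_Collect_eq snd_conv)
qed

lemma induced_simple_graph:
  assumes "simple_graph G" "induced_subgraph (with_proj H) (with_proj G)" "pverts H \<noteq> {}"
  shows "simple_graph H"
  using simple_graphD[OF assms(1)] induced_subgraphD[OF assms(2)] assms(3)
  by (intro simple_graphI) metis+

text \<open>A cycle of \<open>H\<close> is one of \<open>G\<close>, and its chords in
  \<open>G\<close> have both ends in \<open>H\<close>. Therefore equality of \<open>chi_2\<close>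
  and \<open>omega_2\<close> for the graph itself already gives perfection.\<close>

lemma induced_strongly_chordal:
  assumes sc: "strongly_chordal G" and H: "induced_subgraph (with_proj H) (with_proj G)"
  shows "strongly_chordal H"
proof -
  note V = induced_subgraphD(1)[OF H] and E = induced_subgraphD(2)[OF H]
  have "is_cycle G c" if "is_cycle H c" for c
    using that V unfolding is_cycle_iff E by auto
  moreover have "is_chord H c i j" if "is_cycle H c" "is_chord G c i j" for c i j
    using that unfolding is_cycle_iff is_chord_def E by (auto simp: subset_iff)
  ultimately show ?thesis
    using sc unfolding strongly_chordal_def chordal_def by meson
qed

lemma perfect_2_strongly_chordal:
  assumes "simple_graph G" "strongly_chordal G" "d \<ge> 1"
  shows "perfect_2 d G"
  unfolding perfect_2_def
  using assms chi_2_eq_omega_2 induced_simple_graph induced_strongly_chordal by blast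

section \<open>Trees, interval graphs and block graphs\<close>

lemma strongly_chordal_tree:
  assumes "tree_graph G"
  shows "strongly_chordal G"
  using assms unfolding tree_graph_def strongly_chordal_def chordal_def by blast

section \<open>Chords obtained by shifting along a cycle\<close>

text \<open>The bound \<open>2 * k \<le> length c\<close> makes \<open>k\<close> the length of the
  shorter arc. If the shift wraps around, the two positions change order and symmetry of the graph
  is used.\<close>

lemma chord_of_shift:
  assumes G: "simple_graph G" and k: "2 \<le> k" "2 * k \<le> length c"
    and e: "(c ! (r mod length c), c ! ((r + k) mod length c)) \<in> parcs G"
  shows "\<exists>i j. is_chord G c i j \<and> cycle_dist c i j = k"
proof -
  define n where "n = length c"
  define i where "i = r mod n"
  have "n > 0" using k unfolding n_def by linarith
  then have n: "n > 0" "i < n" by (simp_all add: i_def)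
  have mod: "(r + k) mod n = (i + k) mod n"
    by (simp add: i_def mod_add_left_eq)
  show ?thesis
  proof (cases "i + k < n")
    case True
    then have "(r + k) mod n = i + k" using mod by simp
    then have "is_chord G c i (i + k) \<and> cycle_dist c i (i + k) = k"
      using e k True unfolding is_chord_def cycle_dist_def n_def[symmetric] i_def[symmetric] by auto
    then show ?thesis by blast
  next
    case False
    then have "(r + k) mod n = i + k - n" using mod n k by (simp add: mod_if n_def)
    then have "(c ! (i + k - n), c ! i) \<in> parcs G"
      using e simple_graphD(3)[OF G] unfolding n_def[symmetric] i_def[symmetric] by auto
    then have "is_chord G c (i + k - n) i \<and> cycle_dist c (i + k - n) i = k"
      using k False n unfolding is_chord_def cycle_dist_def n_def[symmetric] by auto
    then show ?thesis by blast
  qed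
qed

text \<open>The shifts 2 and 3 are the least cycle distances of a chord and of an odd chord; the
  lengths 4 and 6 are the bounds that \<open>chord_of_shift\<close> asks for.\<close>

lemma strongly_chordalI:
  assumes G: "simple_graph G"
    and "\<And>c. is_cycle G c \<Longrightarrow> length c \<ge> 4 \<Longrightarrow>
      \<exists>r. (c ! (r mod length c), c ! ((r + 2) mod length c)) \<in> parcs G"
    and "\<And>c. is_cycle G c \<Longrightarrow> length c \<ge> 6 \<Longrightarrow>
      \<exists>r. (c ! (r mod length c), c ! ((r + 3) mod length c)) \<in> parcs G"
  shows "strongly_chordal G"
  unfolding strongly_chordal_def chordal_def
proof (intro conjI allI impI)
  fix c assume c: "is_cycle G c \<and> length c \<ge> 4"
  then obtain r where "(c ! (r mod length c), c ! ((r + 2) mod length c)) \<in> parcs G"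
    using assms(2) by blast
  then show "\<exists>i j. is_chord G c i j"
    using chord_of_shift[OF G, of 2 c r] c by auto
next
  fix c assume c: "is_cycle G c \<and> even (length c) \<and> length c \<ge> 6"
  then obtain r where "(c ! (r mod length c), c ! ((r + 3) mod length c)) \<in> parcs G"
    using assms(3) by blast
  then obtain i j where "is_chord G c i j" "cycle_dist c i j = 3"
    using chord_of_shift[OF G, of 3 c r] c by auto
  then show "\<exists>i j. is_chord G c i j \<and> odd (cycle_dist c i j)"
    by (intro exI[of _ i] exI[of _ j]) simp
qed

lemma mod_add_neq:
  fixes r k n :: nat
  assumes "0 < k" "k < n"
  shows "(r + k) mod n \<noteq> r mod n"
proof
  assume "(r + k) mod n = r mod n"
  then have "(r + k) mod n = (r + 0) mod n" by simp
  then have "k mod n = 0 mod n" unfolding add_mod_cancel .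
  then show False using assms by simp
qed

text \<open>Along a cycle choose points \<open>P i\<close> in the intersections of consecutive intervals. The
  interval of the vertex \<open>i + 1\<close> contains the hull of \<open>P i\<close> and \<open>P (i + 1)\<close>; a vertex whose hull
  ends first, at \<open>r\<close> say, has two neighbours whose hulls both contain \<open>r\<close>.\<close>

lemma strongly_chordal_interval:
  assumes G: "simple_graph G" and ig: "interval_graph G"
  shows "strongly_chordal G"
proof -
  obtain I :: "'a \<Rightarrow> real set" where I': "\<forall>v\<in>pverts G. is_interval (I v)"
    "\<forall>u\<in>pverts G. \<forall>v\<in>pverts G. u \<noteq> v \<longrightarrow> ((u, v) \<in> parcs G \<longleftrightarrow> I u \<inter> I v \<noteq> {})"
    using ig unfolding interval_graph_def by (elim exE conjE)
  have I: "is_interval (I v)" if "v \<in> pverts G" for v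
    using I'(1) that by simp
  have adj: "(u, v) \<in> parcs G \<longleftrightarrow> I u \<inter> I v \<noteq> {}" if "u \<in> pverts G" "v \<in> pverts G" "u \<noteq> v" for u v
    using I'(2) that by simp
  have both: "\<exists>r. (c ! (r mod length c), c ! ((r + 2) mod length c)) \<in> parcs G \<and> (length c \<ge> 6 \<longrightarrow>
     (\<exists>r. (c ! (r mod length c), c ! ((r + 3) mod length c)) \<in> parcs G))"
    if c: "is_cycle G c" "length c \<ge> 4" for c
  proof -
    define n where "n = length c"
    define f where "f i = c ! (i mod n)" for i
    have n: "n \<ge> 4" using c(2) by (simp add: n_def)
    have cyc: "distinct c" "set c \<subseteq> pverts G" "\<And>i. i < n \<Longrightarrow> (c ! i, c ! (Suc i mod n)) \<in> parcs G"
      using c(1) unfolding is_cycle_iff n_def by auto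
    have less: "i mod n < n" for i using n by simp
    have fV: "f i \<in> pverts G" for i
      using cyc(2) less[of i] unfolding f_def n_def by (meson nth_mem subsetD)
    have fe: "(f i, f (Suc i)) \<in> parcs G" for i
      using cyc(3)[OF less, of i] unfolding f_def by (simp add: mod_Suc_eq)
    have f_neq: "f i \<noteq> f (i + k)" if "0 < k" "k < n" for i k
      using mod_add_neq[OF that, of i] less cyc(1) unfolding f_def n_def
      by (metis nth_eq_iff_index_eq)
    have arc: "(f i, f (i + k)) \<in> parcs G" if "0 < k" "k < n" "x \<in> I (f i)" "x \<in> I (f (i + k))" for i k x
      using adj[OF fV fV f_neq[OF that(1,2)], of i] that(3,4) by blast
    \<comment> \<open>Choosing at \<open>i mod n\<close> makes \<open>P\<close> periodic, so that
      the right ends \<open>M\<close> below take only finitely many values.\<close>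
    define P where "P i = (SOME x. x \<in> I (f (i mod n)) \<inter> I (f (Suc (i mod n))))" for i
    have P: "P i \<in> I (f i)" "P i \<in> I (f (Suc i))" for i
    proof -
      have "f (i mod n) = f i" "f (Suc (i mod n)) = f (Suc i)"
        unfolding f_def by (simp_all add: mod_Suc_eq)
      then have "P i = (SOME x. x \<in> I (f i) \<inter> I (f (Suc i)))"
        unfolding P_def by (simp only:)
      moreover have "I (f i) \<inter> I (f (Suc i)) \<noteq> {}"
        using adj[OF fV fV, of i "Suc i"] f_neq[of 1 i] fe[of i] n by simp
      ultimately have "P i \<in> I (f i) \<inter> I (f (Suc i))"
        by (metis some_in_eq)
      then show "P i \<in> I (f i)" "P i \<in> I (f (Suc i))" by auto
    qed
    have hull: "x \<in> I (f j)" if j: "j = Suc i" and x: "P i \<le> x \<or> P j \<le> x" "x \<le> P i \<or> x \<le> P j" for x i j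
    proof -
      have "P i \<in> I (f j)" "P j \<in> I (f j)" using P(2)[of i] P(1)[of j] j by auto
      moreover have "P i \<le> x \<and> x \<le> P j \<or> P j \<le> x \<and> x \<le> P i \<or> x = P i \<or> x = P j"
        using x by linarith
      ultimately show ?thesis
        using I[OF fV, of j] unfolding is_interval_1 by metis
    qed
    define M where "M i = max (P i) (P (Suc i))" for i
    have M_mod: "M (i mod n) = M i" for i
      unfolding M_def P_def by (simp add: mod_Suc_eq)
    have "range M \<subseteq> M ` {..<n}"
    proof (rule image_subsetI)
      show "M i \<in> M ` {..<n}" for i
        using less[of i] M_mod[of i] by (metis image_eqI lessThan_iff)
    qed
    then have fin: "finite (range M)"
      by (rule finite_subset) simp
    obtain l' where l': "\<And>k. M l' \<le> M k"
    proof -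
      have "Min (range M) \<in> range M" using Min_in[OF fin] by blast
      then obtain l' where "M l' = Min (range M)" by force
      then show ?thesis using Min_le[OF fin] by (intro that[of l']) simp
    qed
    \<comment> \<open>The minimum moves to index \<open>l + 2\<close>, that is, to the hull of
      vertex \<open>l3\<close>, because the argument reaches back to \<open>P l\<close>; adding
      \<open>2 * n\<close> keeps the subtraction exact.\<close>
    define l where "l = l' + 2 * n - 2"
    have "l + 2 = l' + 2 * n" using n by (simp add: l_def)
    then have "(l + 2) mod n = l' mod n" by simp
    then have min: "M (l + 2) \<le> M k" for k
      using l'[of k] M_mod[of "l + 2"] M_mod[of l'] by simp
    define r where "r = M (l + 2)"
    have r: "r \<le> P k \<or> r \<le> P j" if "j = Suc k" for j k
      using min[of k] that by (auto simp: r_def M_def)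
    obtain l1 l2 l3 l4 l5 where ls: "l1 = Suc l" "l2 = Suc l1" "l3 = Suc l2" "l4 = Suc l3" "l5 = Suc l4"
      by blast
    then have l_add: "l + 2 = l2" "l2 + 2 = l4" "l1 + 3 = l4" "l2 + 3 = l5"
      by simp_all
    have P23: "P l2 \<le> r" "P l3 \<le> r"
      unfolding r_def M_def l_add(1) ls(3) by auto
    have r2: "r \<in> I (f l2)"
      using hull[OF ls(2), of r] P23(1) r[OF ls(2)] by blast
    have r4: "r \<in> I (f l4)"
      using hull[OF ls(4), of r] P23(2) r[OF ls(4)] by blast
    have "(f l2, f (l2 + 2)) \<in> parcs G"
      by (rule arc[where x = r]) (use n r2 r4 l_add(2) in simp_all)
    \<comment> \<open>If \<open>r \<le> P l1 \<le> P l4\<close>, then \<open>P l1\<close> lies in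
      the hull of \<open>l4\<close>; if \<open>P l1 < r\<close>, then the hull of \<open>l1\<close>
      contains \<open>r\<close>. The case \<open>P l4 < P l1\<close> is the mirror image, with
      \<open>l5\<close> and \<open>l2\<close> in place of \<open>l1\<close> and
      \<open>l4\<close>.\<close>
    moreover have "\<exists>i. (f i, f (i + 3)) \<in> parcs G" if "n \<ge> 6"
    proof (cases "P l1 \<le> P l4")
      case True
      have "\<exists>x. x \<in> I (f l1) \<and> x \<in> I (f l4)"
      proof (cases "r \<le> P l1")
        case r_le: True
        have "P l1 \<in> I (f l4)"
          using hull[OF ls(4), of "P l1"] P23(2) r_le True by linarith
        then show ?thesis using P(1) by blast
      next
        case False
        then have "r \<in> I (f l1)"
          using hull[OF ls(1), of r] r[OF ls(1)] by linarith
        then show ?thesis using r4 by blast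
      qed
      then obtain x where "x \<in> I (f l1)" "x \<in> I (f (l1 + 3))" unfolding l_add by blast
      then have "(f l1, f (l1 + 3)) \<in> parcs G"
        by (intro arc[where x = x]) (use n in simp_all)
      then show ?thesis ..
    next
      case False
      have "\<exists>x. x \<in> I (f l2) \<and> x \<in> I (f l5)"
      proof (cases "r \<le> P l4")
        case r_le: True
        have "P l4 \<in> I (f l2)"
          using hull[OF ls(2), of "P l4"] P23(1) r_le False by linarith
        then show ?thesis using P(2)[of l4] ls(5) by blast
      next
        case False
        then have "r \<in> I (f l5)"
          using hull[OF ls(5), of r] r[OF ls(5)] by linarith
        then show ?thesis using r2 by blast
      qed
      then obtain x where "x \<in> I (f l2)" "x \<in> I (f (l2 + 3))" unfolding l_add by blast
      then have "(f l2, f (l2 + 3)) \<in> parcs G"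
        by (intro arc[where x = x]) (use n in simp_all)
      then show ?thesis ..
    qed
    ultimately show ?thesis
      unfolding f_def n_def by blast
  qed
  show ?thesis
    by (rule strongly_chordalI[OF G]) (use both in force)+
qed

section \<open>2-connected subgraphs and blocks\<close>

lemma connected_restrict_iff:
  assumes G: "simple_graph G" and S: "S \<subseteq> pverts G"
  shows "Digraph_Component.connected (with_proj G \<restriction> S) \<longleftrightarrow>
    S \<noteq> {} \<and> (\<forall>u\<in>S. \<forall>v\<in>S. (u, v) \<in> (parcs G \<inter> S \<times> S)\<^sup>*)"
proof -
  define H where "H = mk_symmetric (with_proj G \<restriction> S)"
  have H: "pverts H = S" "parcs H = parcs G \<inter> S \<times> S"
    using simple_graphD(3)[OF G] unfolding H_def mk_symmetric_def induce_subgraph_def by auto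
  have "(u, v) \<in> rtrancl_on S (parcs G \<inter> S \<times> S) \<longleftrightarrow> (u, v) \<in> (parcs G \<inter> S \<times> S)\<^sup>*"
    if "u \<in> S" "v \<in> S" for u v
  proof
    assume "(u, v) \<in> rtrancl_on S (parcs G \<inter> S \<times> S)"
    then show "(u, v) \<in> (parcs G \<inter> S \<times> S)\<^sup>*"
      by (rule rtrancl_on_rtranclI)
  next
    assume "(u, v) \<in> (parcs G \<inter> S \<times> S)\<^sup>*"
    then show "(u, v) \<in> rtrancl_on S (parcs G \<inter> S \<times> S)"
      by (rule rtrancl_consistent_rtrancl_on) (use that in auto)
  qed
  then show ?thesis
    unfolding connected_def strongly_connected_def reachable_def H_def[symmetric]
    by (auto simp: H)
qed

lemma two_connected_iff:
  assumes G: "simple_graph G"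
  shows "two_connected G \<longleftrightarrow> ecard (pverts G) > 2 \<and>
     (\<forall>X \<subseteq> pverts G. ecard X < 2 \<longrightarrow> pverts G - X \<noteq> {} \<and>
        (\<forall>u\<in>pverts G - X. \<forall>v\<in>pverts G - X. (u, v) \<in> (parcs G \<inter> (pverts G - X) \<times> (pverts G - X))\<^sup>*))"
  unfolding two_connected_def connected_restrict_iff[OF G Diff_subset] ..

lemma ecard_less_2: "ecard X < 2 \<Longrightarrow> \<exists>x. X \<subseteq> {x}"
proof -
  assume "ecard X < 2"
  then have "finite X" "card X \<le> 1"
    unfolding ecard_def by (auto split: if_splits simp: numeral_eq_enat)
  then show ?thesis
    by (metis card_le_Suc0_iff_eq One_nat_def insertCI subsetI singletonI equals0I)
qed

lemma sym_restrict:
  assumes "simple_graph G"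
  shows "sym ((parcs G \<inter> S \<times> S)\<^sup>*)"
  using simple_graphD(3)[OF assms] by (intro sym_rtrancl) (auto simp: sym_def)

text \<open>Deleting at most one vertex of a cycle leaves a path through all the others.\<close>

lemma two_connected_cycle:
  assumes G: "simple_graph G" and c: "is_cycle G c"
  defines "B \<equiv> \<lparr>pverts = set c, parcs = parcs G \<inter> set c \<times> set c\<rparr>"
  shows "simple_graph B" "two_connected B"
proof -
  define n where "n = length c"
  have n: "n \<ge> 3" and cyc: "distinct c" "\<And>i. i < n \<Longrightarrow> (c ! i, c ! (Suc i mod n)) \<in> parcs G"
    using c unfolding is_cycle_iff n_def by auto
  have less: "i mod n < n" for i using n by simp
  show B: "simple_graph B"
    using simple_graphD[OF G] n by (intro simple_graphI) (auto simp: B_def n_def)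
  show "two_connected B"
    unfolding two_connected_iff[OF B]
  proof (intro conjI allI impI)
    have "card (set c) = n" using cyc(1) by (simp add: distinct_card n_def)
    then show "2 < ecard (pverts B)"
      using n by (simp add: B_def ecard_def numeral_eq_enat)
  next
    fix X assume X: "X \<subseteq> pverts B" "ecard X < 2"
    define S where "S = set c - X"
    \<comment> \<open>\<open>a\<close> is the number of deleted vertices, and the enumeration of the
      cycle starts at the deleted one, so in both cases the segment from \<open>a\<close> to
      \<open>n - 1\<close> survives.\<close>
    obtain k a where k: "k < n" and a: "X = (\<lambda>j. c ! ((k + j) mod n)) ` {..<a}" "a \<le> 1"
    proof (cases "X = {}")
      case True
      then show ?thesis using n by (intro that[of 0 0]) auto
    next
      case False
      then obtain x where x: "X = {x}" "x \<in> set c"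
        using ecard_less_2[OF X(2)] X(1) unfolding B_def by (metis pair_pre_digraph.select_convs(1) insert_subset subset_singletonD)
      then obtain k where "k < n" "x = c ! k" unfolding n_def by (metis in_set_conv_nth)
      then show ?thesis using x by (intro that[of k 1]) auto
    qed
    define f where "f j = c ! ((k + j) mod n)" for j
    have f_inj: "f i = f j \<longleftrightarrow> i = j" if "i < n" "j < n" for i j
      using that less cyc(1) add_mod_cancel[of k i n j] unfolding f_def n_def
      by (metis mod_less nth_eq_iff_index_eq)
    have f_onto: "f ` {..<n} = set c"
    proof -
      have "f ` {..<n} \<subseteq> set c" using less unfolding f_def n_def by auto
      moreover have "card (f ` {..<n}) = card (set c)"
        using f_inj cyc(1) by (subst card_image) (auto simp: inj_on_def distinct_card n_def)
      ultimately show ?thesis by (simp add: card_subset_eq)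
    qed
    have S: "S = f ` {a..<n}"
    proof -
      have "{a..<n} = {..<n} - {..<a}" by auto
      moreover have "f ` ({..<n} - {..<a}) = f ` {..<n} - f ` {..<a}"
        by (rule inj_on_image_set_diff[of f "{..<n}"]) (use f_inj a(2) n in \<open>auto simp: inj_on_def\<close>)
      ultimately have "f ` {a..<n} = f ` {..<n} - f ` {..<a}"
        by simp
      then show ?thesis using f_onto a(1) unfolding S_def f_def by simp
    qed
    have f_edge: "(f j, f (Suc j)) \<in> parcs G" for j
      using cyc(2)[OF less, of "k + j"] unfolding f_def by (simp add: mod_Suc_eq)
    have path: "(f a, f j) \<in> (parcs B \<inter> S \<times> S)\<^sup>*" if "a \<le> j" "j < n" for j
      using that
    proof (induction j rule: dec_induct)
      case (step j)
      then have "f j \<in> S" "f (Suc j) \<in> S" unfolding S by auto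
      then have "(f j, f (Suc j)) \<in> parcs B \<inter> S \<times> S"
        using f_edge by (auto simp: B_def S_def)
      then show ?case using step by (meson Suc_lessD rtrancl_into_rtrancl)
    qed simp
    show "pverts B - X \<noteq> {}"
      using S n a(2) unfolding S_def B_def by auto
    have "(u, v) \<in> (parcs B \<inter> S \<times> S)\<^sup>*" if "u \<in> S" "v \<in> S" for u v
    proof -
      have "(f a, u) \<in> (parcs B \<inter> S \<times> S)\<^sup>*" "(f a, v) \<in> (parcs B \<inter> S \<times> S)\<^sup>*"
        using that path unfolding S by auto
      then show ?thesis using sym_restrict[OF B] by (meson rtrancl_trans symD)
    qed
    then show "\<forall>u\<in>pverts B - X. \<forall>v\<in>pverts B - X.
        (u, v) \<in> (parcs B \<inter> (pverts B - X) \<times> (pverts B - X))\<^sup>*"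
      unfolding S_def B_def by simp
  qed
qed

lemma subgraph_with_proj_iff:
  assumes "simple_graph H" "simple_graph G"
  shows "subgraph (with_proj H) (with_proj G) \<longleftrightarrow> pverts H \<subseteq> pverts G \<and> parcs H \<subseteq> parcs G"
proof -
  have "wf_digraph (with_proj K)" if "simple_graph K" for K :: "'a pair_pre_digraph"
    using simple_graphD(1,2)[OF that] by unfold_locales auto
  then show ?thesis
    using assms by (auto simp: subgraph_def)
qed

text \<open>The union of all 2-connected subgraphs containing a fixed set of at least two vertices is
  2-connected, so that it is a block.\<close>

lemma ex_max_two_connected_subgraph:
  assumes G: "simple_graph G" and B0: "simple_graph B0" "subgraph (with_proj B0) (with_proj G)" "two_connected B0"
  shows "\<exists>B. max_two_connected_subgraph G B \<and> pverts B0 \<subseteq> pverts B"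
proof -
  define F where "F = {B. simple_graph B \<and> subgraph (with_proj B) (with_proj G) \<and> two_connected B
    \<and> pverts B0 \<subseteq> pverts B}"
  define B where "B = \<lparr>pverts = (\<Union>B\<in>F. pverts B), parcs = (\<Union>B\<in>F. parcs B)\<rparr>"
  have B0F: "B0 \<in> F" using B0 by (simp add: F_def)
  have sub: "pverts K \<subseteq> pverts B" "parcs K \<subseteq> parcs B" if "K \<in> F" for K
    using that by (auto simp: B_def)
  have simple: "simple_graph B"
  proof (rule simple_graphI)
    fix u v assume "(u, v) \<in> parcs B"
    then obtain K where K: "K \<in> F" "(u, v) \<in> parcs K" by (auto simp: B_def)
    then have "simple_graph K" by (simp add: F_def)
    note simple_graphD[OF this]
    then show "u \<in> pverts B \<and> v \<in> pverts B \<and> (v, u) \<in> parcs B \<and> u \<noteq> v"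
      using K sub[OF K(1)] by blast
  next
    show "pverts B \<noteq> {}"
      using sub[OF B0F] B0(1) unfolding simple_graph_def by auto
  qed
  have "two_connected B"
    unfolding two_connected_iff[OF simple]
  proof (intro conjI allI impI)
    have "ecard (pverts B0) \<le> ecard (pverts B)"
      using sub(1)[OF B0F] unfolding ecard_def by (auto intro: card_mono dest: finite_subset)
    then show "2 < ecard (pverts B)"
      using B0(3) unfolding two_connected_def by (meson less_le_trans)
  next
    fix X assume X: "X \<subseteq> pverts B" "ecard X < 2"
    have conn: "(u, v) \<in> (parcs B \<inter> (pverts B - X) \<times> (pverts B - X))\<^sup>*"
      if K: "K \<in> F" and uv: "u \<in> pverts K - X" "v \<in> pverts K - X" for K u v
    proof -
      have "ecard (X \<inter> pverts K) \<le> ecard X"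
        unfolding ecard_def by (auto intro: card_mono)
      then have small: "ecard (X \<inter> pverts K) < 2" using X(2) by simp
      have "two_connected K" "simple_graph K" using K by (auto simp: F_def)
      then have "(u, v) \<in> (parcs K \<inter> (pverts K - X \<inter> pverts K) \<times> (pverts K - X \<inter> pverts K))\<^sup>*"
        using small uv unfolding two_connected_iff[OF \<open>simple_graph K\<close>] by blast
      then show ?thesis
        by (rule rtrancl_mono[THEN subsetD, rotated]) (use sub[OF K] in auto)
    qed
    \<comment> \<open>\<open>B0\<close> has more than two vertices, so one of them survives the
      deletion of \<open>X\<close>. It belongs to all members of \<open>F\<close> and links them to
      each other.\<close>
    have "\<not> pverts B0 \<subseteq> X"
    proof
      assume "pverts B0 \<subseteq> X"
      then have "ecard (pverts B0) \<le> ecard X"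
        unfolding ecard_def by (auto intro: card_mono dest: finite_subset)
      then show False
        using X(2) B0(3) unfolding two_connected_def by (meson less_le_trans not_less_iff_gr_or_eq)
    qed
    then obtain y where y: "y \<in> pverts B0" "y \<notin> X" by blast
    then show "pverts B - X \<noteq> {}" using sub[OF B0F] by blast
    have to_y: "(u, y) \<in> (parcs B \<inter> (pverts B - X) \<times> (pverts B - X))\<^sup>*" if "u \<in> pverts B - X" for u
    proof -
      obtain K where K: "K \<in> F" "u \<in> pverts K" using \<open>u \<in> pverts B - X\<close> by (auto simp: B_def)
      moreover from this have "y \<in> pverts K" using y(1) by (auto simp: F_def)
      ultimately show ?thesis using conn that y(2) by blast
    qed
    show "\<forall>u\<in>pverts B - X. \<forall>v\<in>pverts B - X. (u, v) \<in> (parcs B \<inter> (pverts B - X) \<times> (pverts B - X))\<^sup>*"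
      using to_y sym_restrict[OF simple, of "pverts B - X"] by (meson rtrancl_trans symD)
  qed
  moreover have "subgraph (with_proj B) (with_proj G)"
    unfolding subgraph_with_proj_iff[OF simple G]
    using subgraph_with_proj_iff[OF _ G] by (auto simp: B_def F_def)
  moreover have "B' = B" if B': "simple_graph B'" "subgraph (with_proj B') (with_proj G)" "two_connected B'"
    "subgraph (with_proj B) (with_proj B')" for B'
  proof -
    have B: "pverts B \<subseteq> pverts B'" "parcs B \<subseteq> parcs B'"
      using B'(4) unfolding subgraph_with_proj_iff[OF simple B'(1)] by auto
    then have "B' \<in> F" using B' sub[OF B0F] by (auto simp: F_def)
    then show ?thesis using B sub[of B'] by (intro pair_pre_digraph.equality) auto
  qed
  ultimately have "max_two_connected_subgraph G B"
    unfolding max_two_connected_subgraph_def using simple by blast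
  then show ?thesis using sub[OF B0F] by blast
qed

text \<open>A cycle spans a 2-connected subgraph and so lies within one block. Completeness of the
  block makes all its vertices pairwise adjacent, which provides chords of every distance.\<close>

lemma strongly_chordal_block:
  assumes G: "simple_graph G" and bg: "block_graph G"
  shows "strongly_chordal G"
proof -
  have adj: "(u, v) \<in> parcs G" if c: "is_cycle G c" and uv: "u \<in> set c" "v \<in> set c" "u \<noteq> v" for c u v
  proof -
    define B0 where "B0 = \<lparr>pverts = set c, parcs = parcs G \<inter> set c \<times> set c\<rparr>"
    have B0: "simple_graph B0" "two_connected B0"
      using two_connected_cycle[OF G c] unfolding B0_def .
    have "set c \<subseteq> pverts G" using c unfolding is_cycle_iff by blast
    then have "subgraph (with_proj B0) (with_proj G)"
      unfolding subgraph_with_proj_iff[OF B0(1) G] by (auto simp: B0_def)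
    then obtain B where B: "max_two_connected_subgraph G B" "pverts B0 \<subseteq> pverts B"
      using ex_max_two_connected_subgraph[OF G B0(1) _ B0(2)] by blast
    then have "complete_graph B"
      using bg unfolding block_graph_def is_block_def by blast
    then have "(u, v) \<in> parcs B"
      using uv B(2) unfolding complete_graph_def B0_def by auto
    moreover have "subgraph (with_proj B) (with_proj G)"
      using B(1) unfolding max_two_connected_subgraph_def by blast
    ultimately show ?thesis
      by (auto simp: subgraph_def)
  qed
  have shift: "(c ! (0 mod length c), c ! ((0 + k) mod length c)) \<in> parcs G"
    if c: "is_cycle G c" and k: "0 < k" "k < length c" for c k
  proof -
    have "distinct c" "c \<noteq> []" using c unfolding is_cycle_iff by auto
    then have "c ! 0 \<noteq> c ! k" using k by (simp add: nth_eq_iff_index_eq)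
    then show ?thesis using adj[OF c, of "c ! 0" "c ! k"] k \<open>c \<noteq> []\<close> by simp
  qed
  show ?thesis
  proof (rule strongly_chordalI[OF G])
    show "\<exists>r. (c ! (r mod length c), c ! ((r + 2) mod length c)) \<in> parcs G"
      if "is_cycle G c" "4 \<le> length c" for c
      using shift[of c 2] that by (intro exI[of _ 0]) simp
    show "\<exists>r. (c ! (r mod length c), c ! ((r + 3) mod length c)) \<in> parcs G"
      if "is_cycle G c" "6 \<le> length c" for c
      using shift[of c 3] that by (intro exI[of _ 0]) simp
  qed
qed

theorem corollary3p5:
  fixes d :: nat and G :: "'a pair_pre_digraph"
  assumes "d \<ge> 1" and "simple_graph G"
  shows "(strongly_chordal G \<longrightarrow> perfect_2 d G) \<and>
         (tree_graph G \<longrightarrow> perfect_2 d G) \<and>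
         (block_graph G \<longrightarrow> perfect_2 d G) \<and>
         (interval_graph G \<longrightarrow> perfect_2 d G)"
  using perfect_2_strongly_chordal[OF assms(2) _ assms(1)] strongly_chordal_tree
    strongly_chordal_block[OF assms(2)] strongly_chordal_interval[OF assms(2)] by blast

end
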